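(* Let $p>1$, $q\geq 0$ and $\Phi_{p,q}(t)=t^p(1+\log^+t)^q$. If $w\in A_p^{\rho}$, then there exists $\theta\geq 0$ such that $M^{\rho,\theta}$ is bounded on $L^{\Phi_{p,q}}(w)$; that is, there is a constant $C>0$ with $\|M^{\rho,\theta}f\|_{\Phi_{p,q},w}\le C\|f\|_{\Phi_{p,q},w}$ for every $f\in L^{\Phi_{p,q}}(w)$.
   Context: Throughout, $\rho:\mathbb{R}^n\to(0,\infty)$ is a fixed critical radius function: there are constants $C_0,N_0\ge 1$ such that $$C_0^{-1}\rho(x)\left(1+\frac{|x-y|}{\rho(x)}\right)^{-N_0}\le\rho(y)\le C_0\,\rho(x)\left(1+\frac{|x-y|}{\rho(x)}\right)^{\frac{N_0}{N_0+1}}\quad\text{for all }x,y\in\mathbb{R}^n.$$ Cubes: $Q=Q(x_0,r_0)$ denotes the cube with sides parallel to the coordinate axes, center $x_0$ and "radius" $r_0=\sqrt n\,\ell(Q)/2$, where $\ell(Q)$ is its side length. For $\theta\ge0$, $$M^{\rho,\theta}f(x)=\sup_{Q(x_0,r_0)\ni x}\left(1+\frac{r_0}{\rho(x_0)}\right)^{-\theta}\frac1{|Q|}\int_Q|f(y)|\,dy.$$ For $1<p<\infty$ and $\theta\ge0$, a weight $w$ belongs to $A_p^{\rho,\theta}$ if there is $C>0$ such that $$\left(\frac1{|Q|}\int_Q w\right)^{1/p}\left(\frac1{|Q|}\int_Q w^{1-p'}\right)^{1/p'}\le C\left(1+\frac r{\rho(x)}\right)^\theta$$ for every cube $Q=Q(x,r)$,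 where $1/p+1/p'=1$. $A_p^\rho=\bigcup_{\theta\ge0}A_p^{\rho,\theta}$. For a weight $w$ and a Young function $\Phi$, $\varrho_{\Phi,w}(f)=\int_{\mathbb{R}^n}\Phi(|f(x)|)w(x)\,dx$; $L^\Phi(w)$ is the set of measurable $f$ with $\varrho_{\Phi,w}(f/\lambda)<\infty$ for some $\lambda>0$, with norm $\|f\|_{\Phi,w}=\inf\{\lambda>0:\varrho_{\Phi,w}(f/\lambda)\le1\}$. Here $\log^+t=\max\{0,\log t\}$. *)

theory Defs
  imports "HOL-Analysis.Analysis"
begin

definition critical_radius :: "(real ^ 'n \<Rightarrow> real) \<Rightarrow> bool" where
  "critical_radius \<rho> \<longleftrightarrow>
     (\<forall>x. 0 < \<rho> x) \<and>
     (\<exists>C0\<ge>1. \<exists>N0\<ge>1. \<forall>x y.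
        inverse C0 * \<rho> x * (1 + norm (x - y) / \<rho> x) powr (- N0) \<le> \<rho> y \<and>
        \<rho> y \<le> C0 * \<rho> x * (1 + norm (x - y) / \<rho> x) powr (N0 / (N0 + 1)))"

text \<open>The radius of a cube is half its diagonal, so half the side length is \<open>r / sqrt n\<close>.
  Cubes are taken open. Since boundaries are null sets and averages depend continuously on the
  radius, closed cubes give the same weights and the same maximal functions.\<close>

definition cube :: "real ^ 'n \<Rightarrow> real \<Rightarrow> (real ^ 'n) set" where
  "cube x r = box (\<chi> i. x $ i - r / sqrt (real CARD('n))) (\<chi> i. x $ i + r / sqrt (real CARD('n)))"

definition maximal ::
  "(real ^ 'n \<Rightarrow> real) \<Rightarrow> real \<Rightarrow> (real ^ 'n \<Rightarrow> real) \<Rightarrow> real ^ 'n \<Rightarrow> ennreal" where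
  "maximal \<rho> \<theta> f x =
     (SUP (x0, r0) \<in> {(x0, r0). 0 < r0 \<and> x \<in> cube x0 r0}.
        ennreal ((1 + r0 / \<rho> x0) powr (- \<theta>) * (1 / measure lebesgue (cube x0 r0))) *
        (\<integral>\<^sup>+y\<in>cube x0 r0. ennreal \<bar>f y\<bar> \<partial>lebesgue))"

text \<open>In particular, the integral of a function of \<open>maximal \<rho> \<theta> f\<close> in the modular below is
  an ordinary integral of a measurable function.\<close>

lemma borel_measurable_maximal: "maximal \<rho> \<theta> f \<in> borel_measurable borel"
proof (rule borel_measurableI_greater)
  fix a :: ennreal
  let ?A = "\<lambda>x0 r0. ennreal ((1 + r0 / \<rho> x0) powr (- \<theta>) * (1 / measure lebesgue (cube x0 r0))) *
        (\<integral>\<^sup>+y\<in>cube x0 r0. ennreal \<bar>f y\<bar> \<partial>lebesgue)"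
  have "{x. a < maximal \<rho> \<theta> f x} = \<Union>{cube x0 r0 |x0 r0. 0 < r0 \<and> a < ?A x0 r0}"
    unfolding maximal_def less_SUP_iff by auto
  moreover have "open (\<Union>{cube x0 r0 |x0 r0. 0 < r0 \<and> a < ?A x0 r0})"
    by (auto simp: cube_def)
  ultimately show "{x \<in> space borel. a < maximal \<rho> \<theta> f x} \<in> sets borel"
    by simp
qed

text \<open>Weights are locally integrable and positive almost everywhere; the value of \<open>powr\<close> at
  base \<open>0\<close> is therefore irrelevant below.\<close>

definition weight :: "(real ^ 'n \<Rightarrow> real) \<Rightarrow> bool" where
  "weight w \<longleftrightarrow>
     w \<in> borel_measurable lebesgue \<and>
     (AE x in lebesgue. 0 < w x) \<and>
     (\<forall>K. compact K \<longrightarrow> set_integrable lebesgue K w)"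

text \<open>Bochner integrals of non-integrable functions are \<open>0\<close>, so the finiteness of the integral
  of \<open>w\<^bsup>1-p'\<^esup>\<close> is a separate conjunct. That of \<open>w\<close> is part of \<open>weight\<close>.\<close>

definition A_rho_theta :: "(real ^ 'n \<Rightarrow> real) \<Rightarrow> real \<Rightarrow> real \<Rightarrow> (real ^ 'n \<Rightarrow> real) set" where
  "A_rho_theta \<rho> p \<theta> = {w. weight w \<and>
     (let p' = p / (p - 1) in
      \<exists>C>0. \<forall>x r. 0 < r \<longrightarrow>
        set_integrable lebesgue (cube x r) (\<lambda>y. w y powr (1 - p')) \<and>
        (1 / measure lebesgue (cube x r) * (LINT y:cube x r|lebesgue. w y)) powr (1 / p) *
        (1 / measure lebesgue (cube x r) * (LINT y:cube x r|lebesgue. w y powr (1 - p'))) powr (1 / p')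
        \<le> C * (1 + r / \<rho> x) powr \<theta>)}"

definition A_rho :: "(real ^ 'n \<Rightarrow> real) \<Rightarrow> real \<Rightarrow> (real ^ 'n \<Rightarrow> real) set" where
  "A_rho \<rho> p = (\<Union>\<theta>\<in>{0..}. A_rho_theta \<rho> p \<theta>)"

text \<open>A maximal function may be infinite at some points, so the modular and the norm take the
  absolute value \<open>g = \<bar>f\<bar>\<close> as an \<open>ennreal\<close>-valued argument. A Young function
  tends to infinity, whence the value at \<open>\<infinity>\<close>.\<close>

definition Young_ext :: "(real \<Rightarrow> real) \<Rightarrow> ennreal \<Rightarrow> ennreal" where
  "Young_ext \<Phi> t = (if t = \<infinity> then \<infinity> else ennreal (\<Phi> (enn2real t)))"

definition modular ::
  "(real \<Rightarrow> real) \<Rightarrow> (real ^ 'n \<Rightarrow> real) \<Rightarrow> (real ^ 'n \<Rightarrow> ennreal) \<Rightarrow> ennreal" where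
  "modular \<Phi> w g = (\<integral>\<^sup>+x. Young_ext \<Phi> (g x) * ennreal (w x) \<partial>lebesgue)"

definition Orlicz_space ::
  "(real \<Rightarrow> real) \<Rightarrow> (real ^ 'n \<Rightarrow> real) \<Rightarrow> (real ^ 'n \<Rightarrow> real) set" where
  "Orlicz_space \<Phi> w = {f. f \<in> borel_measurable lebesgue \<and>
     (\<exists>l>0. modular \<Phi> w (\<lambda>x. ennreal \<bar>f x\<bar> / ennreal l) < \<infinity>)}"

text \<open>The infimum of the empty set is \<open>\<infinity>\<close>.\<close>

definition Orlicz_norm ::
  "(real \<Rightarrow> real) \<Rightarrow> (real ^ 'n \<Rightarrow> real) \<Rightarrow> (real ^ 'n \<Rightarrow> ennreal) \<Rightarrow> ennreal" where
  "Orlicz_norm \<Phi> w g = (INF l \<in> {l. 0 < l \<and> modular \<Phi> w (\<lambda>x. g x / ennreal l) \<le> 1}. ennreal l)"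

definition Phi :: "real \<Rightarrow> real \<Rightarrow> real \<Rightarrow> real" where
  "Phi p q t = t powr p * (1 + max 0 (ln t)) powr q"

end

theory Submission
  imports Defs
begin

text \<open>The weight \<open>w\<close> is shown to satisfy the condition \<open>A\<^sub>s\<close> for some \<open>s < p\<close>, up to a
  power of \<open>1 + r / \<rho>\<close>. The dual weight \<open>\<sigma> = w\<^bsup>-1/(p-1)\<^esup>\<close> has the \<open>A\<^sub>\<infinity>\<close> property,
  with uniform constants, on cubes whose radius is at most the critical radius of their centre.
  A dyadic subcube of generation \<open>m\<close> of \<open>Q(x, r)\<close> is of this kind as soon as \<open>2\<^sup>m\<close> exceeds a
  fixed power of \<open>1 + r / \<rho>(x)\<close>. In the Calderon--Zygmund stopping argument for the reverse
  Hoelder inequality, started at the level \<open>2\<^bsup>nm\<^esup>\<close> times the mean of \<open>\<sigma>\<close> over the cube, only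
  cubes of later generations are selected, so the exponent is uniform and the constant grows
  polynomially in \<open>1 + r / \<rho>(x)\<close>. This growth, and that of the doubling constant of \<open>w\<close>, is
  absorbed by taking \<open>\<theta>\<close> large, and the Vitali covering argument gives the weak type \<open>(s, s)\<close>
  inequality. Interpolation with \<open>L\<^sup>\<infinity>\<close> yields a modular inequality, because \<open>\<Phi>(t) / t\<^sup>p\<close> is
  nondecreasing and \<open>s < p\<close>.\<close>

section \<open>Dyadic filtrations and the reverse Hoelder inequality\<close>

text \<open>The bound in the weight condition grows with the cube. If the usual proof of the reverse
  Hoelder inequality were run on large cubes, the A-infinity constant of \<open>\<sigma>\<close>
  could approach 1 and the gain \<open>\<delta>\<close> could approach 0, so no single
  \<open>s < p\<close> would serve all cubes. Raising the starting level moves the dependence on the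
  cube out of the exponent and into the constant, where the factor
  \<open>(1 + r / \<rho> x) powr (- \<theta>)\<close> of the maximal function can pay for it. The
  dual weight is the right one to improve: for \<open>(1 + \<delta>) * (s - 1) = p - 1\<close> the
  dual weight of exponent \<open>s\<close> is \<open>\<sigma> powr (1 + \<delta>)\<close>, so its
  higher integrability is the missing half of the condition with exponent \<open>s\<close>. The
  strict gain matters at the end. Summing weak type bounds over the levels
  \<open>2 ^ k < \<bar>f x\<bar>\<close> produces a geometric series with terms
  \<open>(2 ^ k / \<bar>f x\<bar>) powr (p - s)\<close>; with \<open>s = p\<close> every term would
  be 1.\<close>

lemma emeasure_Union_le_mult:
  assumes "countable F" "disjoint F" "F \<subseteq> sets M" "sets N = sets M"
    and "\<And>A. A \<in> F \<Longrightarrow> emeasure M A \<le> c * emeasure N A"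
  shows "emeasure M (\<Union>F) \<le> c * emeasure N (\<Union>F)"
proof -
  have d: "disjoint_family_on (\<lambda>x. x) F"
    using assms(2) by (auto simp: disjoint_family_on_def disjoint_def)
  have "emeasure M (\<Union>F) = (\<integral>\<^sup>+A. emeasure M A \<partial>count_space F)"
    using emeasure_UN_countable[of F "\<lambda>x. x" M] assms d by auto
  also have "\<dots> \<le> (\<integral>\<^sup>+A. c * emeasure N A \<partial>count_space F)"
    by (intro nn_integral_mono) (use assms in auto)
  also have "\<dots> = c * (\<integral>\<^sup>+A. emeasure N A \<partial>count_space F)"
    by (simp add: nn_integral_cmult)
  also have "(\<integral>\<^sup>+A. emeasure N A \<partial>count_space F) = emeasure N (\<Union>F)"
    by (subst emeasure_UN_countable[of F "\<lambda>x. x" N, simplified, symmetric]) (use assms d in auto)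
  finally show ?thesis .
qed

text \<open>\<open>D m x\<close> stands for the cell of generation \<open>m\<close> containing
  \<open>x\<close>, and \<open>B\<close> for the ratio between the volumes of a cell and of its
  child. Indexing cells by their points turns the selection of maximal cells into a stopping time on
  points. \<open>D_eq\<close> makes cells of one generation equal or disjoint;
  \<open>D_small\<close> is what differentiation of integrals needs.\<close>

locale dyadic_filtration =
  fixes Q :: "'a::euclidean_space set" and D :: "nat \<Rightarrow> 'a \<Rightarrow> 'a set" and B :: real
  assumes Q_sets: "Q \<in> sets lebesgue" and Q_finite: "emeasure lebesgue Q < \<infinity>"
    and Q_pos: "0 < emeasure lebesgue Q"
    and D_0: "x \<in> Q \<Longrightarrow> D 0 x = Q"
    and D_self: "x \<in> Q \<Longrightarrow> x \<in> D m x"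
    and D_eq: "x \<in> Q \<Longrightarrow> y \<in> D m x \<Longrightarrow> D m y = D m x"
    and D_Suc: "x \<in> Q \<Longrightarrow> D (Suc m) x \<subseteq> D m x"
    and D_sets: "x \<in> Q \<Longrightarrow> D m x \<in> sets lebesgue"
    and D_countable: "countable (D m ` Q)"
    and D_vol: "x \<in> Q \<Longrightarrow> emeasure lebesgue Q = ennreal (B ^ m) * emeasure lebesgue (D m x)"
    and D_small: "x \<in> Q \<Longrightarrow> open U \<Longrightarrow> x \<in> U \<Longrightarrow> \<exists>m. D m x \<subseteq> U"
    and B_ge_1: "1 \<le> B"
begin

section \<open>Maximal cells with a given property\<close>

lemma D_mono:
  assumes "x \<in> Q" "i \<le> j" shows "D j x \<subseteq> D i x"
  using assms(2) by (induction rule: dec_induct) (use D_Suc[OF assms(1)] in auto)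

lemma D_subset: "x \<in> Q \<Longrightarrow> D m x \<subseteq> Q"
  using D_mono[of x 0 m] D_0 by auto

text \<open>If \<open>P\<close> says that the mean of \<open>\<sigma>\<close> over a cell exceeds a
  level, this is the level set of the dyadic maximal function relative to \<open>Q\<close>, and
  \<open>stop_cells P\<close> consists of its Calderon--Zygmund cells.\<close>

definition stopped :: "('a set \<Rightarrow> bool) \<Rightarrow> 'a set" where
  "stopped P = {x \<in> Q. \<exists>m. P (D m x)}"

definition stop_time :: "('a set \<Rightarrow> bool) \<Rightarrow> 'a \<Rightarrow> nat" where
  "stop_time P x = (LEAST m. P (D m x))"

definition stop_cells :: "('a set \<Rightarrow> bool) \<Rightarrow> 'a set set" where
  "stop_cells P = (\<lambda>x. D (stop_time P x) x) ` stopped P"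

lemma stopped_subset: "stopped P \<subseteq> Q"
  by (auto simp: stopped_def)

lemma stop_time_holds: "x \<in> stopped P \<Longrightarrow> P (D (stop_time P x) x)"
  unfolding stopped_def stop_time_def by (auto intro: LeastI)

lemma not_before_stop_time: "j < stop_time P x \<Longrightarrow> \<not> P (D j x)"
  unfolding stop_time_def by (rule not_less_Least)

text \<open>Points of one cell share all its ancestors, so they see the same sequence of cells up to
  that generation and stop at the same time. This is why selected cells are disjoint.\<close>

lemma stop_cell_eq:
  assumes "x \<in> stopped P" "y \<in> D (stop_time P x) x"
  shows "y \<in> stopped P" "stop_time P y = stop_time P x"
    "D (stop_time P y) y = D (stop_time P x) x"
proof -
  have x: "x \<in> Q" using assms(1) stopped_subset by auto
  have y: "y \<in> Q" using assms(2) D_subset[OF x] by auto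
  have eq: "D j y = D j x" if "j \<le> stop_time P x" for j
    using D_eq[OF x] D_mono[OF x that] assms(2) by auto
  show y': "y \<in> stopped P"
    unfolding stopped_def using y eq[of "stop_time P x"] stop_time_holds[OF assms(1)]
    by (auto intro!: exI[of _ "stop_time P x"])
  show t: "stop_time P y = stop_time P x"
  proof (rule antisym)
    show "stop_time P y \<le> stop_time P x"
      using not_before_stop_time[of "stop_time P x" P y] eq[of "stop_time P x"]
        stop_time_holds[OF assms(1)] by (metis not_le order_refl)
    show "stop_time P x \<le> stop_time P y"
      using not_before_stop_time[of "stop_time P y" P x] eq[of "stop_time P y"]
        stop_time_holds[OF y'] by (metis not_le less_imp_le)
  qed
  show "D (stop_time P y) y = D (stop_time P x) x"
    using t eq[of "stop_time P x"] by simp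
qed

lemma Union_stop_cells: "\<Union>(stop_cells P) = stopped P"
proof
  show "\<Union>(stop_cells P) \<subseteq> stopped P"
    unfolding stop_cells_def using stop_cell_eq(1) by auto
  show "stopped P \<subseteq> \<Union>(stop_cells P)"
    unfolding stop_cells_def using D_self stopped_subset by blast
qed

lemma stop_cells_cases:
  assumes "T \<in> stop_cells P"
  obtains x where "x \<in> Q" "x \<in> stopped P" "T = D (stop_time P x) x" "P T"
  using assms stop_time_holds stopped_subset[of P] unfolding stop_cells_def by blast

lemma stop_cells_sets: "stop_cells P \<subseteq> sets lebesgue"
  using D_sets by (auto elim!: stop_cells_cases)

lemma countable_stop_cells: "countable (stop_cells P)"
proof (rule countable_subset)
  show "stop_cells P \<subseteq> (\<Union>m. D m ` Q)"
    by (auto elim!: stop_cells_cases)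
qed (auto intro: D_countable)

lemma stopped_sets: "stopped P \<in> sets lebesgue"
  using Union_stop_cells[of P] countable_stop_cells stop_cells_sets
  by (metis sets.countable_Union)

lemma disjoint_stop_cells: "disjoint (stop_cells P)"
proof (rule disjointI)
  fix S T assume "S \<in> stop_cells P" "T \<in> stop_cells P" "S \<noteq> T"
  then obtain x y where xy: "x \<in> stopped P" "S = D (stop_time P x) x"
      "y \<in> stopped P" "T = D (stop_time P y) y"
    by (auto elim!: stop_cells_cases)
  show "S \<inter> T = {}"
  proof (rule ccontr)
    assume "S \<inter> T \<noteq> {}"
    then obtain z where "z \<in> S" "z \<in> T" by auto
    then show False using stop_cell_eq(3)[of x P z] stop_cell_eq(3)[of y P z] xy \<open>S \<noteq> T\<close> by auto
  qed
qed

text \<open>A stronger property cannot occur at an earlier generation, so every cell selected for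
  \<open>P'\<close> lies inside the cell selected for \<open>P\<close> around the same point.
  Consecutive levels of the stopping argument are nested in this way.\<close>

lemma stopped_Int_cell:
  assumes T: "T \<in> stop_cells P" and imp: "\<And>A. P' A \<Longrightarrow> P A"
  shows "stopped P' \<inter> T = \<Union>{T' \<in> stop_cells P'. T' \<subseteq> T}"
proof
  show "\<Union>{T' \<in> stop_cells P'. T' \<subseteq> T} \<subseteq> stopped P' \<inter> T"
    using Union_stop_cells[of P'] by auto
  show "stopped P' \<inter> T \<subseteq> \<Union>{T' \<in> stop_cells P'. T' \<subseteq> T}"
  proof
    fix y assume y: "y \<in> stopped P' \<inter> T"
    obtain x where x: "x \<in> stopped P" "T = D (stop_time P x) x" using T by (auto elim: stop_cells_cases)
    have T': "T = D (stop_time P y) y" using stop_cell_eq(3)[of x P y] x y by auto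
    have yQ: "y \<in> Q" using y stopped_subset by auto
    have "P (D (stop_time P' y) y)" using stop_time_holds imp y by auto
    then have "stop_time P y \<le> stop_time P' y"
      using not_before_stop_time by (metis not_le)
    then have "D (stop_time P' y) y \<subseteq> T" using D_mono[OF yQ] T' by auto
    moreover have "D (stop_time P' y) y \<in> stop_cells P'" using y unfolding stop_cells_def by auto
    ultimately show "y \<in> \<Union>{T' \<in> stop_cells P'. T' \<subseteq> T}"
      using D_self[OF yQ] by auto
  qed
qed

text \<open>A one-sided differentiation theorem, obtained by covering instead of a maximal
  inequality. Let \<open>E\<close> be the exceptional set where \<open>\<sigma>\<close> exceeds
  \<open>L\<close>. The maximal cells inside an open \<open>U\<close> containing \<open>E\<close>
  that meet \<open>E\<close> cover \<open>E\<close>, and none of them satisfies \<open>P\<close>,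
  since each contains a point that is never stopped. Hence \<open>S\<close> has mass at most
  \<open>L\<close> times the volume of \<open>U\<close> on \<open>E\<close>, and \<open>U\<close>
  can be shrunk towards \<open>E\<close>.\<close>

lemma AE_le_of_averages_le:
  fixes \<sigma> :: "'a \<Rightarrow> real"
  assumes \<sigma>[measurable]: "\<sigma> \<in> borel_measurable lebesgue" and "0 \<le> L"
  defines "S \<equiv> density lebesgue (\<lambda>x. ennreal (\<sigma> x))"
  defines "P \<equiv> \<lambda>A. ennreal L * emeasure lebesgue A < emeasure S A"
  shows "AE x in lebesgue. x \<in> Q - stopped P \<longrightarrow> \<sigma> x \<le> L"
proof -
  define E where "E = {x \<in> space lebesgue. L < \<sigma> x} \<inter> (Q - stopped P)"
  have Em[measurable]: "E \<in> sets lebesgue" unfolding E_def using Q_sets stopped_sets by auto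
  have SE: "sets S = sets lebesgue" unfolding S_def by simp
  have "emeasure lebesgue E \<le> emeasure lebesgue Q"
    by (intro emeasure_mono) (auto simp: E_def Q_sets)
  then have Efin: "emeasure lebesgue E < \<infinity>" using Q_finite by auto
  have eps: "emeasure S E \<le> ennreal L * emeasure lebesgue E + ennreal e" if e: "e > 0" for e
  proof -
    \<comment> \<open>The excess volume is multiplied by \<open>L\<close> below, and
      \<open>L\<close> may be 0; hence the denominator \<open>L + 1\<close>.\<close>
    obtain U where U: "open U" "E \<subseteq> U" "U - E \<in> lmeasurable" "emeasure lebesgue (U - E) < ennreal (e / (L + 1))"
      using sets_lebesgue_outer_open[OF Em, of "e / (L + 1)"] e \<open>0 \<le> L\<close> by (auto simp: fmeasurable_def)
    have Um[measurable]: "U \<in> sets lebesgue" using U(1) by auto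
    define F where "F = {T \<in> stop_cells (\<lambda>A. A \<subseteq> U). T \<inter> E \<noteq> {}}"
    have Fsub: "F \<subseteq> stop_cells (\<lambda>A. A \<subseteq> U)" by (auto simp: F_def)
    have cF: "countable F" "disjoint F" "F \<subseteq> sets lebesgue"
      using countable_subset[OF Fsub countable_stop_cells] disjoint_stop_cells
        stop_cells_sets Fsub by (auto intro: pairwise_subset)
    have UF: "\<Union>F \<in> sets lebesgue" using cF by auto
    have EF: "E \<subseteq> \<Union>F"
    proof
      fix x assume x: "x \<in> E"
      then have "x \<in> Q" "x \<in> U" using U(2) by (auto simp: E_def)
      then have "x \<in> stopped (\<lambda>A. A \<subseteq> U)" using D_small[OF \<open>x \<in> Q\<close> U(1)] by (auto simp: stopped_def)
      then obtain T where "T \<in> stop_cells (\<lambda>A. A \<subseteq> U)" "x \<in> T"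
        using Union_stop_cells[of "\<lambda>A. A \<subseteq> U"] by blast
      then show "x \<in> \<Union>F" using x unfolding F_def by blast
    qed
    have FU: "\<Union>F \<subseteq> U" using Fsub stop_cells_cases by blast
    have cell: "emeasure S T \<le> ennreal L * emeasure lebesgue T" if "T \<in> F" for T
    proof -
      from that obtain x where x: "x \<in> stopped (\<lambda>A. A \<subseteq> U)" "T = D (stop_time (\<lambda>A. A \<subseteq> U) x) x"
        using Fsub stop_cells_cases by blast
      obtain y where y: "y \<in> T" "y \<in> E" using \<open>T \<in> F\<close> by (auto simp: F_def)
      have "T = D (stop_time (\<lambda>A. A \<subseteq> U) y) y" using stop_cell_eq(3) x y by metis
      moreover have "\<not> P (D m y)" for m using y by (auto simp: E_def stopped_def)
      ultimately have "\<not> P T" by simp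
      then show ?thesis by (simp add: P_def not_less)
    qed
    have "emeasure S E \<le> emeasure S (\<Union>F)" by (intro emeasure_mono EF) (use UF SE in auto)
    also have "\<dots> \<le> ennreal L * emeasure lebesgue (\<Union>F)"
      by (intro emeasure_Union_le_mult) (use cF SE cell in auto)
    also have "\<dots> \<le> ennreal L * emeasure lebesgue U"
      by (intro mult_left_mono emeasure_mono FU) auto
    also have "emeasure lebesgue U = emeasure lebesgue E + emeasure lebesgue (U - E)"
    proof -
      have "U = E \<union> (U - E)" using U(2) by blast
      then show ?thesis using plus_emeasure[of E lebesgue "U - E"] by (metis Diff_disjoint Em Um sets.Diff)
    qed
    also have "ennreal L * \<dots> \<le> ennreal L * (emeasure lebesgue E + ennreal (e / (L + 1)))"
      by (rule mult_left_mono[OF add_left_mono]) (use U(4) in auto)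
    also have "ennreal L * (emeasure lebesgue E + ennreal (e / (L + 1)))
        = ennreal L * emeasure lebesgue E + ennreal (L * (e / (L + 1)))"
      unfolding distrib_left using \<open>0 \<le> L\<close> e by (intro arg_cong2[where f="(+)"] refl ennreal_mult[symmetric]) auto
    also have "\<dots> \<le> ennreal L * emeasure lebesgue E + ennreal e"
      using \<open>0 \<le> L\<close> e by (intro add_left_mono ennreal_leI) (auto simp: field_simps)
    finally show ?thesis .
  qed
  have SlE: "emeasure S E \<le> ennreal L * emeasure lebesgue E"
    by (rule ennreal_le_epsilon) (rule eps)
  \<comment> \<open>On \<open>E\<close> the weight is \<open>L\<close> plus a positive excess.
    Finiteness of this product allows it to be cancelled, which leaves integral 0 for the
    excess.\<close>
  have lEfin: "ennreal L * emeasure lebesgue E < \<infinity>" using Efin by (simp add: ennreal_mult_less_top)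
  have "emeasure S E = (\<integral>\<^sup>+x. ennreal (\<sigma> x) * indicator E x \<partial>lebesgue)"
    unfolding S_def by (simp add: emeasure_density)
  also have "\<dots> = (\<integral>\<^sup>+x. ennreal L * indicator E x + ennreal (\<sigma> x - L) * indicator E x \<partial>lebesgue)"
    using \<open>0 \<le> L\<close> by (intro nn_integral_cong) (auto simp: E_def indicator_def ennreal_plus[symmetric] simp del: ennreal_plus)
  also have "\<dots> = ennreal L * emeasure lebesgue E + (\<integral>\<^sup>+x. ennreal (\<sigma> x - L) * indicator E x \<partial>lebesgue)"
    by (subst nn_integral_add) (auto simp: nn_integral_cmult)
  finally have eq: "emeasure S E = ennreal L * emeasure lebesgue E + (\<integral>\<^sup>+x. ennreal (\<sigma> x - L) * indicator E x \<partial>lebesgue)" .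
  then have "(\<integral>\<^sup>+x. ennreal (\<sigma> x - L) * indicator E x \<partial>lebesgue) = 0"
    using SlE lEfin ennreal_add_left_cancel_le[of "ennreal L * emeasure lebesgue E" _ 0] by auto
  then have "AE x in lebesgue. ennreal (\<sigma> x - L) * indicator E x = 0"
    by (subst (asm) nn_integral_0_iff_AE) auto
  then show ?thesis
    by eventually_elim (auto simp: E_def indicator_def ennreal_eq_0_iff split: if_splits)
qed

section \<open>Reverse Hoelder inequality for a weight that is A-infinity on late cells\<close>

lemma D_measure:
  assumes "x \<in> Q" "emeasure lebesgue Q = ennreal v" "0 \<le> v"
  shows "emeasure lebesgue (D m x) = ennreal (v / B ^ m)"
proof -
  have B: "0 < B ^ m" using B_ge_1 by simp
  have eq: "ennreal v = ennreal (B ^ m) * emeasure lebesgue (D m x)" using D_vol[OF assms(1)] assms(2) by simp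
  show ?thesis
  proof (cases "emeasure lebesgue (D m x)")
    case (real e)
    then have "ennreal v = ennreal (B ^ m * e)" using eq B by (simp add: ennreal_mult)
    then have "v = B ^ m * e" using assms(3) real B by (subst (asm) ennreal_inj) auto
    then have "e = v / B ^ m" using B_ge_1 by simp
    then show ?thesis using real by simp
  next
    case top
    have "ennreal v = top" unfolding eq top using B B_ge_1 by (subst ennreal_mult_top) auto
    then show ?thesis by simp
  qed
qed

text \<open>Cells are selected at the levels \<open>a ^ k * L\<close>. Inside a cell selected at
  level \<open>k\<close>, the set selected at level \<open>Suc k\<close> fills at most half of the
  volume, hence carries at most the fraction \<open>\<beta>\<close> of the mass. The mass above
  level \<open>k\<close> therefore decays like \<open>\<beta> ^ k\<close>, while
  \<open>\<sigma> powr \<delta>\<close> grows by \<open>(2 * B) powr \<delta>\<close> per level; the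
  product of the two rates is below 1. Only cells of generation beyond \<open>m0\<close> are ever
  selected, so \<open>A_inf\<close> is available for all of them.\<close>

lemma reverse_Hoelder:
  fixes \<sigma> :: "'a \<Rightarrow> real"
  assumes \<sigma>[measurable]: "\<sigma> \<in> borel_measurable lebesgue" and nonneg: "\<And>x. 0 \<le> \<sigma> x"
  defines "S \<equiv> density lebesgue (\<lambda>x. ennreal (\<sigma> x))"
  assumes s: "emeasure S Q = ennreal s" "0 \<le> s" and v: "emeasure lebesgue Q = ennreal v" "0 \<le> v"
    and A_inf: "\<And>x m E. x \<in> Q \<Longrightarrow> m0 \<le> m \<Longrightarrow> E \<in> sets lebesgue \<Longrightarrow> E \<subseteq> D m x \<Longrightarrow>
        2 * emeasure lebesgue E \<le> emeasure lebesgue (D m x) \<Longrightarrow> emeasure S E \<le> ennreal \<beta> * emeasure S (D m x)"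
    and \<beta>: "0 \<le> \<beta>" and \<delta>: "0 < \<delta>" "(2 * B) powr \<delta> * \<beta> < 1"
  shows "(\<integral>\<^sup>+x\<in>Q. ennreal (\<sigma> x powr (1 + \<delta>)) \<partial>lebesgue)
      \<le> ennreal ((B ^ m0 * (s / v)) powr \<delta> * s * (1 + (2 * B) powr \<delta> / (1 - (2 * B) powr \<delta> * \<beta>)))"
proof (cases "s = 0")
  \<comment> \<open>All the levels used in the other case would be 0; here \<open>\<sigma>\<close>
    vanishes almost everywhere on \<open>Q\<close>.\<close>
  case True
  then have "(\<integral>\<^sup>+x. ennreal (\<sigma> x) * indicator Q x \<partial>lebesgue) = 0"
    using s Q_sets by (simp add: S_def emeasure_density)
  then have AE: "AE x in lebesgue. ennreal (\<sigma> x) * indicator Q x = 0"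
    using Q_sets by (subst (asm) nn_integral_0_iff_AE) auto
  have "AE x in lebesgue. ennreal (\<sigma> x powr (1 + \<delta>)) * indicator Q x = 0"
    using AE
  proof eventually_elim
    case (elim x)
    then show ?case using nonneg[of x] by (cases "x \<in> Q") (auto simp: ennreal_eq_0_iff)
  qed
  then have "(\<integral>\<^sup>+x\<in>Q. ennreal (\<sigma> x powr (1 + \<delta>)) \<partial>lebesgue) = 0"
    using Q_sets by (subst nn_integral_0_iff_AE) auto
  then show ?thesis by simp
next
  case False
  then have s0: "0 < s" using s by simp
  have v0: "0 < v" using v Q_pos by simp
  have B0: "0 < B" using B_ge_1 by simp
  \<comment> \<open>The factor \<open>B\<close> compensates the passage from a selected cell to its
    parent, and the factor 2 yields the volume fraction one half that \<open>A_inf\<close> asks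
    for.\<close>
  define a where "a = 2 * B"
  have a1: "1 < a" using B_ge_1 by (simp add: a_def)
  \<comment> \<open>A cell of generation \<open>j\<close> has mean at most
    \<open>B ^ j * (s / v)\<close>, which does not exceed \<open>L\<close> for
    \<open>j \<le> m0\<close>; this proves \<open>early\<close>.\<close>
  define L where "L = B ^ m0 * (s / v)"
  have L0: "0 < L" using s0 v0 B0 by (simp add: L_def)
  define P where "P k A \<longleftrightarrow> ennreal (a ^ k * L) * emeasure lebesgue A < emeasure S A" for k A
  define \<Omega> where "\<Omega> k = stopped (P k)" for k
  have SS[simp]: "sets S = sets lebesgue" by (simp add: S_def)
  have \<Omega>m[measurable]: "\<Omega> k \<in> sets lebesgue" for k unfolding \<Omega>_def by (rule stopped_sets)
  have \<Omega>Q: "\<Omega> k \<subseteq> Q" for k unfolding \<Omega>_def by (rule stopped_subset)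
  have imp: "P k A" if "P (Suc k) A" for k A
  proof -
    have "a ^ k * L \<le> a ^ Suc k * L" using a1 L0 by (intro mult_right_mono power_increasing) auto
    then have "ennreal (a ^ k * L) * emeasure lebesgue A \<le> ennreal (a ^ Suc k * L) * emeasure lebesgue A"
      by (rule mult_right_mono[OF ennreal_leI]) simp
    then show ?thesis using that unfolding P_def by (rule le_less_trans)
  qed
  have \<Omega>_mono: "\<Omega> (Suc k) \<subseteq> \<Omega> k" for k
    unfolding \<Omega>_def stopped_def using imp by auto
  have early: "\<not> P k (D j x)" if "x \<in> Q" "j \<le> m0" for k j x
  proof -
    have "emeasure S (D j x) \<le> ennreal s"
      using emeasure_mono[OF D_subset[OF that(1), of j], of S] Q_sets s by simp
    also have "s \<le> a ^ k * L * (v / B ^ j)"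
    proof -
      have "s = 1 * (L * (v / B ^ m0))" using v0 B0 by (simp add: L_def)
      also have "\<dots> \<le> a ^ k * (L * (v / B ^ j))"
        using a1 L0 v0 B_ge_1 that B0
        by (intro mult_mono divide_left_mono power_increasing) auto
      finally show ?thesis by (simp add: mult.assoc)
    qed
    then have "ennreal s \<le> ennreal (a ^ k * L) * emeasure lebesgue (D j x)"
      using D_measure[OF that(1) v] a1 L0 v0 B0 by (simp add: ennreal_mult[symmetric] ennreal_leI)
    finally show ?thesis by (simp add: P_def)
  qed
  have step: "emeasure S (\<Omega> (Suc k)) \<le> ennreal \<beta> * emeasure S (\<Omega> k)" for k
  proof -
    \<comment> \<open>\<open>M\<close> is \<open>S\<close> restricted to the next level set, so that
      the bound on each cell can be summed as a comparison of two measures.\<close>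
    define M where "M = density lebesgue (\<lambda>x. ennreal (\<sigma> x) * indicator (\<Omega> (Suc k)) x)"
    have M: "emeasure M T = emeasure S (\<Omega> (Suc k) \<inter> T)" if [measurable]: "T \<in> sets lebesgue" for T
      unfolding M_def S_def
      by (auto simp: emeasure_density indicator_def intro!: nn_integral_cong)
    have "emeasure M (\<Union>(stop_cells (P k))) \<le> ennreal \<beta> * emeasure S (\<Union>(stop_cells (P k)))"
    proof (rule emeasure_Union_le_mult)
      fix T assume T: "T \<in> stop_cells (P k)"
      then have Tm[measurable]: "T \<in> sets lebesgue" using stop_cells_sets by auto
      from T obtain x where x: "x \<in> Q" "x \<in> stopped (P k)" "T = D (stop_time (P k) x) x" "P k T"
        by (rule stop_cells_cases)
      \<comment> \<open>Since the root is not selected, \<open>T\<close> has a parent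
        \<open>D m x\<close>. The parent fails \<open>P k\<close>, which bounds the mass of the
        parent, and hence of \<open>T\<close>, by \<open>a ^ k * L\<close> times the volume of the
        parent.\<close>
      have late: "m0 < stop_time (P k) x"
        using early[OF x(1), of "stop_time (P k) x" k] x(3,4) by (metis not_le)
      then obtain m where m: "stop_time (P k) x = Suc m" by (cases "stop_time (P k) x") auto
      have "\<not> P k (D m x)" using not_before_stop_time[of m "P k" x] m by simp
      then have "emeasure S (D m x) \<le> ennreal (a ^ k * L) * ennreal (v / B ^ m)"
        using D_measure[OF x(1) v] by (simp add: P_def not_less)
      then have ST: "emeasure S T \<le> ennreal (a ^ k * L * (v / B ^ m))"
        using emeasure_mono[OF D_Suc[OF x(1), of m], of S] D_sets[OF x(1), of m] x(3) m a1 L0 v0 B0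
        by (simp add: ennreal_mult[symmetric])
      define E where "E = \<Omega> (Suc k) \<inter> T"
      define F where "F = {T' \<in> stop_cells (P (Suc k)). T' \<subseteq> T}"
      have EF: "E = \<Union>F" unfolding E_def F_def \<Omega>_def using T imp by (rule stopped_Int_cell)
      have Fsub: "F \<subseteq> stop_cells (P (Suc k))" by (auto simp: F_def)
      \<comment> \<open>Each cell of \<open>F\<close> has mean above \<open>a ^ Suc k * L\<close>.
        Together with the bound on the mass of \<open>T\<close> this gives the volume of the parent
        divided by \<open>a = 2 * B\<close>, which is half the volume of \<open>T\<close>.\<close>
      have "emeasure lebesgue (\<Union>F) \<le> ennreal (1 / (a ^ Suc k * L)) * emeasure S (\<Union>F)"
      proof (rule emeasure_Union_le_mult)
        show "countable F" "disjoint F" "F \<subseteq> sets lebesgue"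
          using countable_subset[OF Fsub countable_stop_cells] disjoint_stop_cells
            stop_cells_sets Fsub by (auto intro: pairwise_subset)
        fix A assume "A \<in> F"
        then have "P (Suc k) A" using Fsub by (auto elim: stop_cells_cases)
        then have "ennreal (1 / (a ^ Suc k * L)) * (ennreal (a ^ Suc k * L) * emeasure lebesgue A)
            \<le> ennreal (1 / (a ^ Suc k * L)) * emeasure S A"
          unfolding P_def by (intro mult_left_mono) auto
        moreover have "ennreal (1 / (a ^ Suc k * L)) * ennreal (a ^ Suc k * L) = 1"
          using a1 L0 by (subst ennreal_mult[symmetric]) auto
        ultimately show "emeasure lebesgue A \<le> ennreal (1 / (a ^ Suc k * L)) * emeasure S A"
          by (simp add: mult.assoc[symmetric])
      qed simp
      also have "\<dots> \<le> ennreal (1 / (a ^ Suc k * L)) * ennreal (a ^ k * L * (v / B ^ m))"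
        using ST order_trans[OF emeasure_mono[of E T S]] by (intro mult_left_mono) (auto simp: EF[symmetric] E_def)
      also have "\<dots> = ennreal (v / B ^ Suc m / 2)"
        using a1 L0 v0 B0 by (subst ennreal_mult[symmetric]) (auto simp: a_def field_simps)
      finally have "2 * emeasure lebesgue E \<le> ennreal (2 * (v / B ^ Suc m / 2))"
        using v0 B0 unfolding EF by (subst ennreal_mult) (auto intro!: mult_left_mono)
      then have "2 * emeasure lebesgue E \<le> emeasure lebesgue T"
        using D_measure[OF x(1) v, of "Suc m"] x(3) m by simp
      moreover have "E \<in> sets lebesgue" "E \<subseteq> T" by (auto simp: E_def)
      ultimately have "emeasure S E \<le> ennreal \<beta> * emeasure S T"
        using A_inf[OF x(1) less_imp_le[OF late]] unfolding x(3)[symmetric] by blast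
      then show "emeasure M T \<le> ennreal \<beta> * emeasure S T" using M[OF Tm] by (simp add: E_def)
    qed (use countable_stop_cells disjoint_stop_cells stop_cells_sets in \<open>auto simp: M_def S_def\<close>)
    then show ?thesis
      using \<Omega>_mono[of k] M[OF \<Omega>m] unfolding Union_stop_cells \<Omega>_def[symmetric]
      by (simp add: Int_absorb2)
  qed
  have decay: "emeasure S (\<Omega> k) \<le> ennreal (\<beta> ^ k * s)" for k
  proof (induction k)
    case 0
    then show ?case using emeasure_mono[OF \<Omega>Q[of 0], of S] Q_sets s by simp
  next
    case (Suc k)
    have "emeasure S (\<Omega> (Suc k)) \<le> ennreal \<beta> * ennreal (\<beta> ^ k * s)"
      using step[of k] Suc by (meson mult_left_mono order_trans zero_le)
    then show ?case using \<beta> s by (simp add: ennreal_mult[symmetric] mult.assoc)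
  qed
  have \<beta>1: "\<beta> < 1"
  proof -
    have "1 \<le> (2 * B) powr \<delta>" using a1 \<delta>(1) by (simp add: a_def ge_one_powr_ge_zero)
    then show ?thesis using \<delta>(2) \<beta> by (metis le_less_trans mult_right_mono mult_1)
  qed
  \<comment> \<open>On \<open>Z\<close> no level bounds \<open>\<sigma>\<close>. It is enough that
    \<open>Z\<close> has \<open>S\<close>-mass 0, because then \<open>\<sigma>\<close> is 0 almost
    everywhere on \<open>Z\<close> and the integrand vanishes there.\<close>
  define Z where "Z = (\<Inter>k. \<Omega> k)"
  have Zm[measurable]: "Z \<in> sets lebesgue" unfolding Z_def by auto
  have "emeasure S Z = 0"
  proof -
    have "emeasure S Z \<le> ennreal (\<beta> ^ k * s)" for k
      by (rule order_trans[OF emeasure_mono decay[of k]]) (auto simp: Z_def)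
    moreover have "(\<lambda>k. ennreal (\<beta> ^ k * s)) \<longlonglongrightarrow> ennreal (0 * s)"
      using \<beta> \<beta>1 by (intro tendsto_ennrealI tendsto_mult LIMSEQ_realpow_zero) auto
    ultimately have "emeasure S Z \<le> ennreal (0 * s)"
      by (intro LIMSEQ_le_const[where X="\<lambda>k. ennreal (\<beta> ^ k * s)"]) auto
    then show ?thesis by simp
  qed
  then have "(\<integral>\<^sup>+x. ennreal (\<sigma> x) * indicator Z x \<partial>lebesgue) = 0"
    by (simp add: S_def emeasure_density)
  then have AE_Z: "AE x in lebesgue. ennreal (\<sigma> x) * indicator Z x = 0"
    by (subst (asm) nn_integral_0_iff_AE) auto
  have AE_le: "AE x in lebesgue. \<forall>k. x \<in> Q - \<Omega> k \<longrightarrow> \<sigma> x \<le> a ^ k * L"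
    unfolding AE_all_countable
    using AE_le_of_averages_le[OF \<sigma>, of "a ^ k * L" for k] a1 L0
    unfolding \<Omega>_def P_def S_def by auto
  \<comment> \<open>\<open>g k\<close> dominates \<open>\<sigma> powr (1 + \<delta>)\<close> on the
    layer between levels \<open>k\<close> and \<open>Suc k\<close>. Keeping all of
    \<open>\<Omega> k\<close> in place of the layer is harmless, since its mass already decays
    geometrically.\<close>
  define g where "g k x = ennreal ((a ^ Suc k * L) powr \<delta>) * (ennreal (\<sigma> x) * indicator (\<Omega> k) x)" for k x
  have gm[measurable]: "g k \<in> borel_measurable lebesgue" for k unfolding g_def by measurable
  have bound: "AE x in lebesgue. ennreal (\<sigma> x powr (1 + \<delta>)) * indicator Q x
      \<le> ennreal (L powr \<delta>) * (ennreal (\<sigma> x) * indicator Q x) + (\<Sum>k. g k x)"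
    using AE_Z AE_le
  proof eventually_elim
    case (elim x)
    have le: "ennreal (\<sigma> x powr (1 + \<delta>)) \<le> ennreal (c powr \<delta>) * ennreal (\<sigma> x)" if "\<sigma> x \<le> c" for c
    proof -
      have "\<sigma> x powr (1 + \<delta>) = \<sigma> x powr \<delta> * \<sigma> x"
        using nonneg[of x] by (cases "\<sigma> x = 0") (auto simp: powr_add)
      also have "\<dots> \<le> c powr \<delta> * \<sigma> x"
        using nonneg[of x] that \<delta> by (intro mult_right_mono powr_mono2) auto
      finally show ?thesis using nonneg[of x] by (simp add: ennreal_mult[symmetric] ennreal_leI)
    qed
    consider "x \<notin> Q" | "x \<in> Q" "x \<notin> \<Omega> 0" | k where "x \<in> Q" "x \<in> \<Omega> k" "x \<notin> \<Omega> (Suc k)" | "x \<in> Q" "x \<in> Z"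
    proof -
      have "x \<in> \<Omega> k" if "x \<in> \<Omega> 0" "\<And>k. x \<in> \<Omega> k \<Longrightarrow> x \<in> \<Omega> (Suc k)" for k
        by (induction k) (use that in auto)
      then show ?thesis using that unfolding Z_def by blast
    qed
    then show ?case
    proof cases
      case 1 then show ?thesis by simp
    next
      case 2
      then have "\<sigma> x \<le> L" using elim(2)[rule_format, of 0] by simp
      then show ?thesis using le[of L] 2 by (simp add: add_increasing2)
    next
      case 3
      then have "\<sigma> x \<le> a ^ Suc k * L" using elim(2)[rule_format, of "Suc k"] by simp
      then have "ennreal (\<sigma> x powr (1 + \<delta>)) \<le> g k x" using le 3 unfolding g_def by simp
      also have "\<dots> \<le> (\<Sum>k. g k x)"
        using sum_le_suminf[of "\<lambda>k. g k x" "{k}"] by simp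
      finally show ?thesis using 3 by (simp add: add_increasing)
    next
      case 4
      then have "\<sigma> x = 0" using elim(1) nonneg[of x] by (simp add: ennreal_eq_0_iff)
      then show ?thesis by simp
    qed
  qed
  define c where "c = a powr \<delta>"
  have c: "0 < c" "c * \<beta> < 1" using \<delta> a1 by (auto simp: c_def a_def)
  have gint: "(\<integral>\<^sup>+x. g k x \<partial>lebesgue) \<le> ennreal (L powr \<delta> * s * c * (c * \<beta>) ^ k)" for k
  proof -
    have "(\<integral>\<^sup>+x. g k x \<partial>lebesgue) = ennreal ((a ^ Suc k * L) powr \<delta>) * emeasure S (\<Omega> k)"
      unfolding g_def S_def by (simp add: nn_integral_cmult emeasure_density)
    also have "\<dots> \<le> ennreal ((a ^ Suc k * L) powr \<delta>) * ennreal (\<beta> ^ k * s)"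
      by (intro mult_left_mono decay) auto
    also have "\<dots> = ennreal ((a ^ Suc k * L) powr \<delta> * (\<beta> ^ k * s))"
      using \<beta> s by (simp add: ennreal_mult)
    also have "(a ^ Suc k * L) powr \<delta> = c ^ Suc k * L powr \<delta>"
    proof -
      have "(a ^ Suc k) powr \<delta> = c ^ Suc k"
        using a1 by (simp add: c_def powr_realpow[symmetric] powr_powr mult.commute[of \<delta>] del: power_Suc)
      then show ?thesis using a1 L0 by (simp add: powr_mult del: power_Suc)
    qed
    finally show ?thesis by (simp add: power_mult_distrib mult_ac)
  qed
  have "(\<integral>\<^sup>+x\<in>Q. ennreal (\<sigma> x powr (1 + \<delta>)) \<partial>lebesgue)
     \<le> (\<integral>\<^sup>+x. ennreal (L powr \<delta>) * (ennreal (\<sigma> x) * indicator Q x) + (\<Sum>k. g k x) \<partial>lebesgue)"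
    by (rule nn_integral_mono_AE) (rule bound)
  also have "\<dots> = ennreal (L powr \<delta>) * emeasure S Q + (\<Sum>k. \<integral>\<^sup>+x. g k x \<partial>lebesgue)"
    using Q_sets by (subst nn_integral_add) (auto simp: nn_integral_cmult nn_integral_suminf S_def emeasure_density)
  also have "\<dots> \<le> ennreal (L powr \<delta> * s) + (\<Sum>k. ennreal (L powr \<delta> * s * c * (c * \<beta>) ^ k))"
    using s by (intro add_mono suminf_le gint) (auto simp: ennreal_mult)
  also have "(\<Sum>k. ennreal (L powr \<delta> * s * c * (c * \<beta>) ^ k)) = ennreal (L powr \<delta> * s * c * (1 / (1 - c * \<beta>)))"
    using c \<beta> s by (intro suminf_ennreal_eq sums_mult geometric_sums) auto
  also have "ennreal (L powr \<delta> * s) + \<dots> = ennreal (L powr \<delta> * s + L powr \<delta> * s * c * (1 / (1 - c * \<beta>)))"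
    using c s by (subst ennreal_plus) auto
  also have "L powr \<delta> * s + L powr \<delta> * s * c * (1 / (1 - c * \<beta>))
      = L powr \<delta> * s * (1 + c / (1 - c * \<beta>))"
    by (simp add: algebra_simps)
  finally show ?thesis unfolding c_def a_def L_def .
qed

end

section \<open>Hoelder's inequality with a weight\<close>

text \<open>Hoelder's inequality for the splitting of \<open>f\<close> into
  \<open>f * w powr (1 / s)\<close> and \<open>w powr (- 1 / s)\<close>; the conjugate power of the
  second factor is \<open>w powr (- 1 / (s - 1))\<close>. The cases \<open>a = 0\<close> and
  \<open>b = 0\<close> are separate because the factors are normalised by division.\<close>

lemma nn_integral_le_weighted_Hoelder:
  fixes f w :: "'a \<Rightarrow> real"
  assumes [measurable]: "f \<in> borel_measurable M" "w \<in> borel_measurable M" "Q \<in> sets M"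
    and f: "\<And>x. 0 \<le> f x" and w: "\<And>x. 0 < w x" and s: "1 < s"
    and A: "(\<integral>\<^sup>+x\<in>Q. ennreal (f x powr s * w x) \<partial>M) = ennreal a" "0 \<le> a"
    and B: "(\<integral>\<^sup>+x\<in>Q. ennreal (w x powr (- 1 / (s - 1))) \<partial>M) = ennreal b" "0 \<le> b"
  shows "(\<integral>\<^sup>+x\<in>Q. ennreal (f x) \<partial>M) \<le> ennreal (a powr (1 / s) * b powr ((s - 1) / s))"
proof -
  consider "a = 0" | "b = 0" | "0 < a" "0 < b" using A B by force
  then show ?thesis
  proof cases
    case 1
    then have "(\<integral>\<^sup>+x\<in>Q. ennreal (f x powr s * w x) \<partial>M) = 0" using A by simp
    then have "AE x in M. ennreal (f x powr s * w x) * indicator Q x = 0"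
      by (subst (asm) nn_integral_0_iff_AE) auto
    then have "AE x in M. ennreal (f x) * indicator Q x = 0"
    proof eventually_elim
      case (elim x)
      then show ?case using f[of x] w[of x]
        by (cases "x \<in> Q") (auto simp: ennreal_eq_0_iff mult_le_0_iff)
    qed
    then have "(\<integral>\<^sup>+x\<in>Q. ennreal (f x) \<partial>M) = 0" by (subst nn_integral_0_iff_AE) auto
    then show ?thesis by simp
  next
    case 2
    then have "(\<integral>\<^sup>+x\<in>Q. ennreal (w x powr (- 1 / (s - 1))) \<partial>M) = 0" using B by simp
    then have "AE x in M. ennreal (w x powr (- 1 / (s - 1))) * indicator Q x = 0"
      by (subst (asm) nn_integral_0_iff_AE) auto
    then have "AE x in M. ennreal (f x) * indicator Q x = 0"
    proof eventually_elim
      case (elim x)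
      then show ?case using w[of x]
        by (cases "x \<in> Q") (auto simp: ennreal_eq_0_iff)
    qed
    then have "(\<integral>\<^sup>+x\<in>Q. ennreal (f x) \<partial>M) = 0" by (subst nn_integral_0_iff_AE) auto
    then show ?thesis by simp
  next
    case 3
    define s' where "s' = s / (s - 1)"
    have s': "1 < s'" "1 / s + 1 / s' = 1" using s by (auto simp: s'_def field_simps)
    \<comment> \<open>\<open>c\<close> is the asserted bound. Young's inequality for the normalised
      factors, multiplied by \<open>c\<close>, integrates to \<open>c * (1 / s + 1 / s')\<close>,
      which is \<open>c\<close>.\<close>
    define c where "c = a powr (1 / s) * b powr ((s - 1) / s)"
    have c: "0 < c" using 3 by (simp add: c_def)
    have lin: "ennreal (p * X + q * Y) = ennreal p * ennreal X + ennreal q * ennreal Y"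
      if "0 \<le> p" "0 \<le> q" "0 \<le> X" "0 \<le> Y" for p q X Y
      using that by (simp add: ennreal_mult)
    have pw: "f x \<le> c / (s * a) * (f x powr s * w x) + c / (s' * b) * w x powr (- 1 / (s - 1))" for x
    proof -
      define u where "u = f x * w x powr (1 / s) / a powr (1 / s)"
      define v where "v = w x powr (- 1 / s) / b powr ((s - 1) / s)"
      have "u * v \<le> u powr s / s + v powr s' / s'"
        by (rule Youngs_inequality) (use s s' f[of x] in \<open>auto simp: u_def v_def\<close>)
      moreover have "u * v = f x / c"
        using w[of x] by (simp add: u_def v_def c_def powr_minus field_simps)
      moreover have "u powr s = f x powr s * w x / a"
        using w[of x] f[of x] 3 s by (simp add: u_def powr_mult powr_divide powr_powr)
      moreover have "v powr s' = w x powr (- 1 / (s - 1)) / b"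
        using w[of x] 3 s by (simp add: v_def powr_divide powr_powr s'_def)
      ultimately have "f x / c \<le> f x powr s * w x / a / s + w x powr (- 1 / (s - 1)) / b / s'" by simp
      then have "c * (f x / c) \<le> c * (f x powr s * w x / a / s + w x powr (- 1 / (s - 1)) / b / s')"
        using c by (intro mult_left_mono) auto
      then show ?thesis using c by (simp add: field_simps)
    qed
    have "(\<integral>\<^sup>+x\<in>Q. ennreal (f x) \<partial>M) \<le> (\<integral>\<^sup>+x. ennreal (c / (s * a)) * (ennreal (f x powr s * w x) * indicator Q x)
        + ennreal (c / (s' * b)) * (ennreal (w x powr (- 1 / (s - 1))) * indicator Q x) \<partial>M)"
    proof (rule nn_integral_mono)
      fix x
      have "ennreal (f x) \<le> ennreal (c / (s * a)) * ennreal (f x powr s * w x) + ennreal (c / (s' * b)) * ennreal (w x powr (- 1 / (s - 1)))"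
      proof -
        show ?thesis
          using ennreal_leI[OF pw[of x]] c s s' 3 f[of x] w[of x] by (subst (asm) lin) auto
      qed
      then show "ennreal (f x) * indicator Q x \<le> ennreal (c / (s * a)) * (ennreal (f x powr s * w x) * indicator Q x)
        + ennreal (c / (s' * b)) * (ennreal (w x powr (- 1 / (s - 1))) * indicator Q x)"
        by (cases "x \<in> Q") auto
    qed
    also have "\<dots> = ennreal (c / (s * a)) * ennreal a + ennreal (c / (s' * b)) * ennreal b"
      unfolding A(1)[symmetric] B(1)[symmetric]
      by (subst nn_integral_add) (auto simp: nn_integral_cmult)
    also have "\<dots> = ennreal (c / (s * a) * a + c / (s' * b) * b)"
      using c s s' 3 by (subst lin) auto
    also have "c / (s * a) * a + c / (s' * b) * b = c * (1 / s + 1 / s')"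
      using 3 by (simp add: field_simps)
    finally show ?thesis unfolding c_def using s' by simp
  qed
qed

section \<open>Cubes and dyadic cells\<close>

lemma mem_cube: "y \<in> cube x r \<longleftrightarrow> (\<forall>i. \<bar>y $ i - x $ i\<bar> < r / sqrt (real CARD('n)))"
  for x y :: "real ^ 'n"
  by (auto simp: cube_def mem_box_cart abs_less_iff algebra_simps)

lemma open_cube: "open (cube x r)"
  unfolding cube_def by (rule open_box)

lemma cube_sets[measurable]: "cube x r \<in> sets lebesgue"
  by (simp add: cube_def)

lemma emeasure_cube:
  fixes x :: "real ^ 'n"
  assumes "0 < r"
  shows "emeasure lebesgue (cube x r) = ennreal ((2 * r / sqrt (real CARD('n))) ^ CARD('n))"
proof -
  let ?a = "\<chi> i. x $ i - r / sqrt (real CARD('n))" and ?b = "\<chi> i. x $ i + r / sqrt (real CARD('n))"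
  have le: "?a $ i \<le> ?b $ i" for i using assms by simp
  have "emeasure lborel (box ?a ?b) = emeasure lborel (cbox ?a ?b)"
    by (simp add: emeasure_lborel_box_eq emeasure_lborel_cbox_eq)
  also have "\<dots> = ennreal (measure lborel (cbox ?a ?b))"
    using emeasure_eq_ennreal_measure[of lborel "cbox ?a ?b"] emeasure_lborel_cbox_finite[of ?a ?b] by simp
  also have "measure lborel (cbox ?a ?b) = (\<Prod>i\<in>UNIV. ?b $ i - ?a $ i)"
    using le by (intro content_cbox_cart) (auto simp: interval_ne_empty_cart)
  finally show ?thesis by (simp add: cube_def)
qed

lemma measure_cube:
  fixes x :: "real ^ 'n"
  assumes "0 < r"
  shows "measure lebesgue (cube x r) = (2 * r / sqrt (real CARD('n))) ^ CARD('n)"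
  using emeasure_cube[OF assms, of x] assms by (simp add: measure_def)

lemma norm_diff_le_of_coordinates_le:
  fixes x y :: "real ^ 'n"
  assumes "\<And>i. \<bar>y $ i - x $ i\<bar> \<le> r / sqrt (real CARD('n))" "0 \<le> r"
  shows "norm (x - y) \<le> r"
proof -
  have "norm (x - y) = sqrt (\<Sum>i\<in>UNIV. \<bar>x $ i - y $ i\<bar>\<^sup>2)"
    by (simp add: norm_vec_def L2_set_def)
  also have "\<dots> \<le> sqrt (\<Sum>i\<in>(UNIV::'n set). (r / sqrt (real CARD('n)))\<^sup>2)"
    using assms(1) by (intro real_sqrt_le_mono sum_mono power_mono) (auto simp: abs_minus_commute)
  also have "\<dots> = r" using assms(2) by (simp add: power_divide real_sqrt_unique)
  finally show ?thesis .
qed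

lemma cube_mono: "r \<le> s \<Longrightarrow> cube x r \<subseteq> cube x s"
  unfolding mem_cube subset_iff by (meson divide_right_mono less_le_trans of_nat_0_le_iff real_sqrt_ge_zero)

lemma cube_subset_triple:
  assumes "cube x r \<inter> cube y s \<noteq> {}" "r \<le> s"
  shows "cube x r \<subseteq> cube y (3 * s)"
proof
  fix z assume z: "z \<in> cube x r"
  obtain u where u: "u \<in> cube x r" "u \<in> cube y s" using assms(1) by auto
  let ?h = "\<lambda>r. r / sqrt (real CARD('a))"
  have rs: "?h r \<le> ?h s" using assms(2) by (intro divide_right_mono) auto
  have "\<bar>z $ i - y $ i\<bar> < ?h (3 * s)" for i
  proof -
    have "\<bar>z $ i - x $ i\<bar> < ?h r" "\<bar>u $ i - x $ i\<bar> < ?h r" "\<bar>u $ i - y $ i\<bar> < ?h s"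
      using z u by (auto simp: mem_cube)
    moreover have "?h (3 * s) = 3 * ?h s" by simp
    ultimately show ?thesis using rs by linarith
  qed
  then show "z \<in> cube y (3 * s)" by (simp add: mem_cube)
qed

text \<open>The half-open cell of side \<open>l / 2 ^ m\<close> around \<open>x\<close> in the grid
  with origin \<open>a\<close>. Equality of integer parts makes membership an equivalence relation,
  so the cells partition space exactly, boundaries included.\<close>

definition dyadic_cell :: "real ^ 'n \<Rightarrow> real \<Rightarrow> nat \<Rightarrow> real ^ 'n \<Rightarrow> (real ^ 'n) set" where
  "dyadic_cell a l m x = {y. \<forall>i. \<lfloor>2 ^ m * (y $ i - a $ i) / l\<rfloor> = \<lfloor>2 ^ m * (x $ i - a $ i) / l\<rfloor>}"

text \<open>The interior of a cell is a cube around the midpoint of the cell, and the rest lies in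
  the negligible frontier of a box. The factor \<open>sqrt (real CARD('n))\<close> converts half a
  side into a radius. That the centre lies in the cell is used to estimate the critical radius
  there.\<close>

lemma dyadic_cell_cube:
  fixes a x :: "real ^ 'n"
  assumes l: "0 < l"
  obtains c where "c \<in> dyadic_cell a l m x"
    "cube c (sqrt (real CARD('n)) * (l / 2) / 2 ^ m) \<subseteq> dyadic_cell a l m x"
    "dyadic_cell a l m x - cube c (sqrt (real CARD('n)) * (l / 2) / 2 ^ m) \<in> null_sets lebesgue"
proof -
  define k where "k i = real_of_int \<lfloor>2 ^ m * (x $ i - a $ i) / l\<rfloor>" for i
  define d where "d = l / 2 ^ m"
  have d: "0 < d" using l by (simp add: d_def)
  define c where "c = (\<chi> i. a $ i + d * (k i + 1/2))"
  have cell: "y \<in> dyadic_cell a l m x \<longleftrightarrow> (\<forall>i. a $ i + d * k i \<le> y $ i \<and> y $ i < a $ i + d * (k i + 1))" for y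
  proof -
    have "\<lfloor>2 ^ m * (y $ i - a $ i) / l\<rfloor> = \<lfloor>2 ^ m * (x $ i - a $ i) / l\<rfloor> \<longleftrightarrow>
        a $ i + d * k i \<le> y $ i \<and> y $ i < a $ i + d * (k i + 1)" for i
      unfolding floor_eq_iff k_def[symmetric] d_def using l by (simp add: field_simps)
    then show ?thesis by (simp add: dyadic_cell_def)
  qed
  have h: "sqrt (real CARD('n)) * (l / 2) / 2 ^ m / sqrt (real CARD('n)) = d / 2"
    by (simp add: d_def)
  let ?u = "\<chi> i. a $ i + d * k i" and ?v = "\<chi> i. a $ i + d * (k i + 1)"
  have cube: "cube c (sqrt (real CARD('n)) * (l / 2) / 2 ^ m) = box ?u ?v"
    unfolding cube_def h by (intro arg_cong2[where f=box]) (auto simp: vec_eq_iff c_def algebra_simps)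
  have "dyadic_cell a l m x \<subseteq> cbox ?u ?v"
    by (auto simp: cell mem_box_cart less_imp_le)
  then have "negligible (dyadic_cell a l m x - box ?u ?v)"
    using negligible_subset[OF negligible_frontier_interval[of ?u ?v]] by blast
  then have "dyadic_cell a l m x - cube c (sqrt (real CARD('n)) * (l / 2) / 2 ^ m) \<in> null_sets lebesgue"
    unfolding cube by (simp add: negligible_iff_null_sets)
  moreover have "c \<in> dyadic_cell a l m x" using d by (auto simp: cell c_def)
  moreover have "box ?u ?v \<subseteq> dyadic_cell a l m x" by (auto simp: cell mem_box_cart less_imp_le)
  ultimately show ?thesis using that cube by auto
qed

lemma dyadic_cell_sets:
  assumes "0 < l" shows "dyadic_cell a l m x \<in> sets lebesgue"
proof -
  obtain c where "cube c (sqrt (real CARD('a)) * (l / 2) / 2 ^ m) \<subseteq> dyadic_cell a l m x"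
    and "dyadic_cell a l m x - cube c (sqrt (real CARD('a)) * (l / 2) / 2 ^ m) \<in> null_sets lebesgue"
    using dyadic_cell_cube[OF assms] by metis
  then show ?thesis
    by (metis Diff_partition cube_sets null_setsD2 sets.Un)
qed

lemma emeasure_dyadic_cell:
  fixes a x :: "real ^ 'n"
  assumes "0 < l" shows "emeasure lebesgue (dyadic_cell a l m x) = ennreal ((l / 2 ^ m) ^ CARD('n))"
proof -
  let ?r = "sqrt (real CARD('n)) * (l / 2) / 2 ^ m"
  obtain c where c: "cube c ?r \<subseteq> dyadic_cell a l m x" "dyadic_cell a l m x - cube c ?r \<in> null_sets lebesgue"
    using dyadic_cell_cube[OF assms] by metis
  have "emeasure lebesgue (dyadic_cell a l m x) = emeasure lebesgue (cube c ?r)"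
    using c by (metis Diff_partition cube_sets emeasure_Un_null_set)
  also have "\<dots> = ennreal ((l / 2 ^ m) ^ CARD('n))"
    using assms by (subst emeasure_cube) auto
  finally show ?thesis .
qed

lemma dyadic_cell_dist:
  assumes "0 < l" "y \<in> dyadic_cell a l m x"
  shows "\<bar>y $ i - x $ i\<bar> < l / 2 ^ m"
proof -
  have eq: "\<lfloor>2 ^ m * (y $ i - a $ i) / l\<rfloor> = \<lfloor>2 ^ m * (x $ i - a $ i) / l\<rfloor>"
    using assms(2) by (auto simp: dyadic_cell_def)
  then have "\<bar>2 ^ m * (y $ i - a $ i) / l - 2 ^ m * (x $ i - a $ i) / l\<bar> < 1"
    by linarith
  also have "2 ^ m * (y $ i - a $ i) / l - 2 ^ m * (x $ i - a $ i) / l = (2 ^ m / l) * (y $ i - x $ i)"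
    by (simp add: algebra_simps diff_divide_distrib)
  also have "\<bar>\<dots>\<bar> = (2 ^ m / l) * \<bar>y $ i - x $ i\<bar>"
    using assms(1) by (simp add: abs_mult)
  finally show ?thesis using assms(1) by (simp add: field_simps)
qed

lemma dyadic_filtration_dyadic_cell:
  fixes a x0 :: "real ^ 'n"
  assumes l: "0 < l"
  shows "dyadic_filtration (dyadic_cell a l 0 x0) (dyadic_cell a l) (2 ^ CARD('n))"
proof
  show "dyadic_cell a l 0 x0 \<in> sets lebesgue" by (rule dyadic_cell_sets[OF l])
  show "emeasure lebesgue (dyadic_cell a l 0 x0) < \<infinity>" "0 < emeasure lebesgue (dyadic_cell a l 0 x0)"
    using l by (auto simp: emeasure_dyadic_cell)
  fix x m assume x: "x \<in> dyadic_cell a l 0 x0"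
  show "dyadic_cell a l 0 x = dyadic_cell a l 0 x0" using x by (auto simp: dyadic_cell_def)
  show "x \<in> dyadic_cell a l m x" by (auto simp: dyadic_cell_def)
  show "dyadic_cell a l m y = dyadic_cell a l m x" if "y \<in> dyadic_cell a l m x" for y
    using that by (auto simp: dyadic_cell_def)
  show "dyadic_cell a l m x \<in> sets lebesgue" by (rule dyadic_cell_sets[OF l])
  show "dyadic_cell a l (Suc m) x \<subseteq> dyadic_cell a l m x"
  proof -
    \<comment> \<open>The index of the parent is the index of the child halved and rounded
      down.\<close>
    have "\<lfloor>2 ^ m * t / l\<rfloor> = \<lfloor>2 ^ Suc m * t / l\<rfloor> div 2" for t
      using floor_divide_real_eq_div[of 2 "2 ^ Suc m * t / l"] by simp
    then show ?thesis by (auto simp: dyadic_cell_def simp del: power_Suc)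
  qed
  show "emeasure lebesgue (dyadic_cell a l 0 x0) = ennreal ((2 ^ CARD('n)) ^ m) * emeasure lebesgue (dyadic_cell a l m x)"
    using l by (simp add: emeasure_dyadic_cell ennreal_mult[symmetric] power_divide power_mult[symmetric] mult.commute)
  show "\<exists>m. dyadic_cell a l m x \<subseteq> U" if U: "open U" "x \<in> U" for U
  proof -
    obtain e where e: "0 < e" "ball x e \<subseteq> U" using U by (meson open_contains_ball)
    \<comment> \<open>Each of the \<open>CARD('n')\<close> coordinates contributes at most
      \<open>l / 2 ^ m\<close> to the sum norm, which dominates the Euclidean norm.\<close>
    obtain m where m: "real CARD('n) * l / e < 2 ^ m" using real_arch_pow[of 2] by auto
    have "dyadic_cell a l m x \<subseteq> ball x e"
    proof
      fix y assume y: "y \<in> dyadic_cell a l m x"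
      have "norm (y - x) \<le> (\<Sum>i\<in>UNIV. \<bar>(y - x) $ i\<bar>)" by (rule norm_le_l1_cart)
      also have "\<dots> \<le> (\<Sum>i\<in>(UNIV::'n set). l / 2 ^ m)"
        using dyadic_cell_dist[OF l y] by (intro sum_mono) (simp add: less_imp_le)
      also have "\<dots> < e" using m e by (simp add: field_simps)
      finally show "y \<in> ball x e" by (simp add: dist_norm norm_minus_commute)
    qed
    then show ?thesis using e by blast
  qed
next
  fix m
  have "dyadic_cell a l m ` dyadic_cell a l 0 x0 \<subseteq>
      range (\<lambda>k. {y. \<forall>i. \<lfloor>2 ^ m * (y $ i - a $ i) / l\<rfloor> = (k i :: int)})"
    by (auto simp: dyadic_cell_def)
  then show "countable (dyadic_cell a l m ` dyadic_cell a l 0 x0)"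
    by (rule countable_subset) auto
qed simp_all

section \<open>Self-improvement of the weight condition\<close>

text \<open>\<open>Ap\<close> is the \<open>p\<close>-th power of the defining inequality, in the
  classical form of a mean times the power \<open>p - 1\<close> of the dual mean. Positivity of
  \<open>v\<close> at every point lets identities between powers of \<open>v\<close> hold without
  exceptional sets.\<close>

locale Ap_weight =
  fixes \<rho> v :: "real ^ 'n \<Rightarrow> real" and p C \<theta> C0 N0 :: real
  assumes v_meas[measurable]: "v \<in> borel_measurable lebesgue" and v_pos: "0 < v x"
    and p: "1 < p" and C: "0 < C" and \<theta>: "0 \<le> \<theta>" and C0: "1 \<le> C0" and N0: "1 \<le> N0"
    and \<rho>_pos: "0 < \<rho> x"
    and \<rho>_lower: "inverse C0 * \<rho> x * (1 + norm (x - y) / \<rho> x) powr (- N0) \<le> \<rho> y"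
    and v_finite: "0 < r \<Longrightarrow> (\<integral>\<^sup>+y\<in>cube x r. ennreal (v y) \<partial>lebesgue) < \<infinity>"
    and dual_finite: "0 < r \<Longrightarrow> (\<integral>\<^sup>+y\<in>cube x r. ennreal (v y powr (- 1 / (p - 1))) \<partial>lebesgue) < \<infinity>"
    and Ap: "0 < r \<Longrightarrow>
        enn2real (\<integral>\<^sup>+y\<in>cube x r. ennreal (v y) \<partial>lebesgue) / measure lebesgue (cube x r) *
        (enn2real (\<integral>\<^sup>+y\<in>cube x r. ennreal (v y powr (- 1 / (p - 1))) \<partial>lebesgue) / measure lebesgue (cube x r)) powr (p - 1)
        \<le> C * (1 + r / \<rho> x) powr \<theta>"
begin

section \<open>The dual weight and its A-infinity property on subcritical cubes\<close>

definition \<sigma> :: "real ^ 'n \<Rightarrow> real" where "\<sigma> y = v y powr (- 1 / (p - 1))"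

definition S :: "(real ^ 'n) measure" where "S = density lebesgue (\<lambda>x. ennreal (\<sigma> x))"

definition W :: "(real ^ 'n) measure" where "W = density lebesgue (\<lambda>x. ennreal (v x))"

lemma \<sigma>_meas[measurable]: "\<sigma> \<in> borel_measurable lebesgue" unfolding \<sigma>_def by measurable

lemma \<sigma>_pos: "0 < \<sigma> x" using v_pos[of x] by (simp add: \<sigma>_def)

lemma sets_S[simp]: "sets S = sets lebesgue" and sets_W[simp]: "sets W = sets lebesgue"
  by (simp_all add: S_def W_def)

lemma emeasure_S: "A \<in> sets lebesgue \<Longrightarrow> emeasure S A = (\<integral>\<^sup>+y\<in>A. ennreal (\<sigma> y) \<partial>lebesgue)"
  by (simp add: S_def emeasure_density)

lemma emeasure_W: "A \<in> sets lebesgue \<Longrightarrow> emeasure W A = (\<integral>\<^sup>+y\<in>A. ennreal (v y) \<partial>lebesgue)"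
  by (simp add: W_def emeasure_density)

lemma W_cube: "0 < r \<Longrightarrow> emeasure W (cube x r) = ennreal (measure W (cube x r))"
  using v_finite[of r x] emeasure_W[OF cube_sets, of x r] by (intro emeasure_eq_ennreal_measure) auto

lemma S_cube: "0 < r \<Longrightarrow> emeasure S (cube x r) = ennreal (measure S (cube x r))"
  using dual_finite[of r x] emeasure_S[OF cube_sets, of x r]
  by (intro emeasure_eq_ennreal_measure) (auto simp: \<sigma>_def)

lemma Ap_cube:
  assumes "0 < r"
  shows "measure W (cube x r) / measure lebesgue (cube x r) *
     (measure S (cube x r) / measure lebesgue (cube x r)) powr (p - 1) \<le> C * (1 + r / \<rho> x) powr \<theta>"
  using Ap[OF assms, of x] emeasure_S[OF cube_sets, of x r] emeasure_W[OF cube_sets, of x r]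
  by (simp add: measure_def \<sigma>_def)

text \<open>Hoelder's inequality for the constant 1 on \<open>E\<close> bounds the volume of
  \<open>E\<close> by powers of its \<open>S\<close>-mass and \<open>W\<close>-mass. Since
  \<open>E\<close> fills half of the cube, this is a lower bound for the \<open>S\<close>-mass of
  \<open>E\<close>, and the weight condition removes the \<open>W\<close>-mass. The constant is
  uniform because \<open>1 + r / \<rho> x\<close> is at most 2.\<close>

lemma dual_mass_le:
  assumes r: "0 < r" "r \<le> \<rho> x" and E[measurable]: "E \<in> sets lebesgue" and sub: "E \<subseteq> cube x r"
    and half: "measure lebesgue (cube x r) \<le> 2 * measure lebesgue E"
  shows "measure S (cube x r) \<le> (C * 2 powr \<theta> * 2 powr p) powr (1 / (p - 1)) * measure S E"
proof -
  define V where "V = measure lebesgue (cube x r)"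
  have V: "0 < V" using r by (simp add: V_def measure_cube)
  have Efin: "emeasure S E = ennreal (measure S E)" "emeasure W E = ennreal (measure W E)"
    using emeasure_mono[OF sub, of S] emeasure_mono[OF sub, of W] S_cube[OF r(1)] W_cube[OF r(1)]
    by (auto intro!: emeasure_eq_ennreal_measure simp: top_unique)
  have LE: "emeasure lebesgue E = ennreal (measure lebesgue E)"
  proof (rule emeasure_eq_ennreal_measure)
    show "emeasure lebesgue E \<noteq> top"
      using emeasure_mono[OF sub, of lebesgue] unfolding emeasure_cube[OF r(1), of x]
      by (metis cube_sets ennreal_neq_top top_unique)
  qed
  define s where "s = measure S (cube x r)"
  define sE where "sE = measure S E"
  define w where "w = measure W (cube x r)"
  have nn: "0 \<le> s" "0 \<le> sE" "0 \<le> w" by (auto simp: s_def sE_def w_def)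
  have wE: "measure W E \<le> w"
    unfolding w_def using r sub W_cube[OF r(1), of x] by (intro measure_mono_fmeasurable) (auto simp: fmeasurable_def)
  have p': "1 < p / (p - 1)" using p by (simp add: field_simps)
  \<comment> \<open>The inequality is used with the conjugate exponent \<open>p / (p - 1)\<close>
    and the weight \<open>\<sigma>\<close>; the first identity says that the dual of
    \<open>\<sigma>\<close> for that exponent is \<open>v\<close> again.\<close>
  have ex: "(- 1 / (p - 1)) * (- 1 / (p / (p - 1) - 1)) = 1" "(p / (p - 1) - 1) / (p / (p - 1)) = 1 / p"
    using p by (auto simp: field_simps)
  have "(\<integral>\<^sup>+x\<in>E. ennreal 1 \<partial>lebesgue) \<le>
      ennreal (sE powr (1 / (p / (p - 1))) * measure W E powr ((p / (p - 1) - 1) / (p / (p - 1))))"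
  proof (rule nn_integral_le_weighted_Hoelder[where w = \<sigma>])
    show "(\<integral>\<^sup>+x\<in>E. ennreal (1 powr (p / (p - 1)) * \<sigma> x) \<partial>lebesgue) = ennreal sE"
      using Efin by (simp add: emeasure_S sE_def)
    show "(\<integral>\<^sup>+x\<in>E. ennreal (\<sigma> x powr (- 1 / (p / (p - 1) - 1))) \<partial>lebesgue) = ennreal (measure W E)"
      using Efin less_imp_le[OF v_pos] by (simp add: emeasure_W \<sigma>_def powr_powr ex(1)[simplified])
  qed (use p' \<sigma>_pos in \<open>auto simp: sE_def\<close>)
  then have "ennreal (measure lebesgue E) \<le> ennreal (sE powr ((p - 1) / p) * measure W E powr (1 / p))"
    using LE unfolding ex(2) by simp
  then have "measure lebesgue E \<le> sE powr ((p - 1) / p) * measure W E powr (1 / p)"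
    by (simp add: ennreal_le_iff)
  also have "\<dots> \<le> sE powr ((p - 1) / p) * w powr (1 / p)"
    using wE p by (intro mult_left_mono powr_mono2) auto
  finally have "V / 2 \<le> sE powr ((p - 1) / p) * w powr (1 / p)" using half by (simp add: V_def)
  then have "(V / 2) powr p \<le> (sE powr ((p - 1) / p) * w powr (1 / p)) powr p"
    using V p by (intro powr_mono2) auto
  also have "\<dots> = sE powr (p - 1) * w"
    using nn p by (simp add: powr_mult powr_powr)
  finally have h1: "V powr p \<le> 2 powr p * (sE powr (p - 1) * w)"
    using V by (simp add: powr_divide field_simps)
  have h2: "w * s powr (p - 1) \<le> C * 2 powr \<theta> * V powr p"
  proof -
    have "(1 + r / \<rho> x) powr \<theta> \<le> 2 powr \<theta>"
      using r \<rho>_pos[of x] \<theta> by (intro powr_mono2) (auto simp: field_simps)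
    then have "C * (1 + r / \<rho> x) powr \<theta> \<le> C * 2 powr \<theta>" using C by simp
    then have "w / V * (s / V) powr (p - 1) \<le> C * 2 powr \<theta>"
      using Ap_cube[OF r(1), of x] by (simp add: s_def w_def V_def)
    moreover have "w / V * (s / V) powr (p - 1) = w * s powr (p - 1) / V powr p"
      using V nn by (simp add: powr_divide powr_diff)
    ultimately have "w * s powr (p - 1) / V powr p \<le> C * 2 powr \<theta>" by simp
    then show ?thesis using V by (simp add: pos_divide_le_eq)
  qed
  \<comment> \<open>Multiplying by \<open>s powr (p - 1)\<close> creates the product
    \<open>w * s powr (p - 1)\<close> that \<open>h2\<close> bounds, so \<open>w\<close> disappears
    without being divided by.\<close>
  have "V powr p * s powr (p - 1) \<le> 2 powr p * (sE powr (p - 1) * w) * s powr (p - 1)"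
    using h1 by (intro mult_right_mono) auto
  also have "\<dots> = 2 powr p * sE powr (p - 1) * (w * s powr (p - 1))" by simp
  also have "\<dots> \<le> 2 powr p * sE powr (p - 1) * (C * 2 powr \<theta> * V powr p)"
    using h2 by (intro mult_left_mono) auto
  also have "\<dots> = V powr p * (C * 2 powr \<theta> * 2 powr p * sE powr (p - 1))" by simp
  finally have "s powr (p - 1) \<le> C * 2 powr \<theta> * 2 powr p * sE powr (p - 1)"
    using V by (simp add: mult_le_cancel_left_pos)
  then have "(s powr (p - 1)) powr (1 / (p - 1)) \<le> (C * 2 powr \<theta> * 2 powr p * sE powr (p - 1)) powr (1 / (p - 1))"
    using p by (intro powr_mono2) auto
  then show ?thesis
    using p C nn by (simp add: powr_powr powr_mult s_def sE_def)
qed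

text \<open>Passing to complements: if \<open>E\<close> fills at most half of the cube, its
  complement fills at least half and so carries at least the fraction \<open>1 / \<Gamma>\<close> of
  the mass.\<close>

lemma dual_A_infinity:
  obtains \<beta> where "0 < \<beta>" "\<beta> < 1"
    "\<And>x r E. 0 < r \<Longrightarrow> r \<le> \<rho> x \<Longrightarrow> E \<in> sets lebesgue \<Longrightarrow> E \<subseteq> cube x r \<Longrightarrow>
        2 * emeasure lebesgue E \<le> emeasure lebesgue (cube x r) \<Longrightarrow>
        emeasure S E \<le> ennreal \<beta> * emeasure S (cube x r)"
proof -
  \<comment> \<open>The maximum with 2 makes \<open>1 - 1 / \<Gamma>\<close> positive, so that its
    logarithm can be used to choose the exponent of the reverse Hoelder inequality.\<close>
  define \<Gamma> where "\<Gamma> = max 2 ((C * 2 powr \<theta> * 2 powr p) powr (1 / (p - 1)))"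
  have \<Gamma>: "2 \<le> \<Gamma>" by (simp add: \<Gamma>_def)
  have "emeasure S E \<le> ennreal (1 - 1 / \<Gamma>) * emeasure S (cube x r)"
    if r: "0 < r" "r \<le> \<rho> x" and [measurable]: "E \<in> sets lebesgue" and sub: "E \<subseteq> cube x r"
      and half: "2 * emeasure lebesgue E \<le> emeasure lebesgue (cube x r)" for x r E
  proof -
    let ?Q = "cube x r"
    have fin: "emeasure lebesgue ?Q \<noteq> \<infinity>" "emeasure S ?Q \<noteq> \<infinity>"
      using emeasure_cube[OF r(1), of x] S_cube[OF r(1), of x] by auto
    have finE: "emeasure lebesgue E \<noteq> \<infinity>" "emeasure S E \<noteq> \<infinity>"
      using emeasure_mono[OF sub, of lebesgue] emeasure_mono[OF sub, of S] fin by (auto simp: top_unique)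
    have meas: "measure lebesgue ?Q = measure lebesgue E + measure lebesgue (?Q - E)"
      "measure S ?Q = measure S E + measure S (?Q - E)"
      using measure_Diff[of lebesgue ?Q E] measure_Diff[of S ?Q E] fin sub by auto
    have "2 * measure lebesgue E \<le> measure lebesgue ?Q"
    proof -
      have "ennreal (2 * measure lebesgue E) \<le> ennreal (measure lebesgue ?Q)"
        using half fin finE emeasure_eq_ennreal_measure[of lebesgue E] emeasure_eq_ennreal_measure[of lebesgue ?Q]
        by (simp add: ennreal_mult)
      then show ?thesis by (simp add: ennreal_le_iff)
    qed
    then have "measure S ?Q \<le> (C * 2 powr \<theta> * 2 powr p) powr (1 / (p - 1)) * measure S (?Q - E)"
      using meas(1) r by (intro dual_mass_le) auto
    also have "\<dots> \<le> \<Gamma> * measure S (?Q - E)"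
      by (intro mult_right_mono) (auto simp: \<Gamma>_def)
    finally have "measure S E \<le> (1 - 1 / \<Gamma>) * measure S ?Q"
      using meas(2) \<Gamma> by (simp add: field_simps)
    then have "ennreal (measure S E) \<le> ennreal ((1 - 1 / \<Gamma>) * measure S ?Q)" by (rule ennreal_leI)
    then show ?thesis
      using \<Gamma> fin finE emeasure_eq_ennreal_measure[of S E] emeasure_eq_ennreal_measure[of S ?Q]
      by (simp add: ennreal_mult)
  qed
  then show ?thesis using \<Gamma> by (intro that[of "1 - 1 / \<Gamma>"]) auto
qed

text \<open>The exponent \<open>\<delta>\<close> depends only on \<open>\<beta>\<close> and the
  dimension. The cube enters through the generation \<open>m0\<close> alone, and
  \<open>(2 ^ n) ^ m0\<close> is bounded by a constant times a power of
  \<open>1 + r / \<rho> x\<close>.\<close>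

lemma dual_reverse_Hoelder:
  obtains \<delta> K \<kappa> where "0 < \<delta>" "0 < K" "0 \<le> \<kappa>"
    "\<And>x r. 0 < r \<Longrightarrow> (\<integral>\<^sup>+y\<in>cube x r. ennreal (\<sigma> y powr (1 + \<delta>)) \<partial>lebesgue)
      \<le> ennreal (K * (1 + r / \<rho> x) powr \<kappa> * (measure S (cube x r) / measure lebesgue (cube x r)) powr \<delta> * measure S (cube x r))"
proof -
  obtain \<beta> where \<beta>: "0 < \<beta>" "\<beta> < 1" and A_inf: "\<And>x r E. 0 < r \<Longrightarrow> r \<le> \<rho> x \<Longrightarrow> E \<in> sets lebesgue \<Longrightarrow>
        E \<subseteq> cube x r \<Longrightarrow> 2 * emeasure lebesgue E \<le> emeasure lebesgue (cube x r) \<Longrightarrow>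
        emeasure S E \<le> ennreal \<beta> * emeasure S (cube x r)"
    using dual_A_infinity by blast
  define n where "n = CARD('n)"
  define B :: real where "B = 2 ^ n"
  have B: "1 \<le> B" by (simp add: B_def)
  \<comment> \<open>Chosen so that \<open>(2 * B) powr \<delta>\<close> is
    \<open>\<beta> powr (- 1 / 2)\<close>; the product with \<open>\<beta>\<close> is then
    \<open>\<beta> powr (1 / 2)\<close>, below 1.\<close>
  define \<delta> where "\<delta> = - ln \<beta> / (2 * ln (2 * B))"
  have \<delta>: "0 < \<delta>" using \<beta> B by (simp add: \<delta>_def divide_neg_pos)
  have "(2 * B) powr \<delta> * \<beta> = \<beta> powr (1 / 2)"
  proof -
    have "(2 * B) powr \<delta> = exp (- ln \<beta> / 2)" using B by (simp add: powr_def \<delta>_def)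
    moreover have "\<beta> = exp (ln \<beta>)" using \<beta> by simp
    ultimately have "(2 * B) powr \<delta> * \<beta> = exp (- ln \<beta> / 2 + ln \<beta>)" by (metis exp_add)
    then show ?thesis using \<beta> by (simp add: powr_def)
  qed
  also have "\<dots> < 1" using \<beta> by (simp add: powr_def)
  finally have \<delta>\<beta>: "(2 * B) powr \<delta> * \<beta> < 1" .
  define G where "G = 1 + (2 * B) powr \<delta> / (1 - (2 * B) powr \<delta> * \<beta>)"
  have G: "0 < G" using \<delta>\<beta> by (simp add: G_def add_pos_nonneg)
  have "(\<integral>\<^sup>+y\<in>cube x r. ennreal (\<sigma> y powr (1 + \<delta>)) \<partial>lebesgue)
      \<le> ennreal (((2 * C0) ^ n) powr \<delta> * G * (1 + r / \<rho> x) powr ((N0 + 1) * n * \<delta>)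
          * (measure S (cube x r) / measure lebesgue (cube x r)) powr \<delta> * measure S (cube x r))"
    if r: "0 < r" for x r
  proof -
    define u where "u = 1 + r / \<rho> x"
    have u: "1 \<le> u" using r \<rho>_pos[of x] by (simp add: u_def)
    \<comment> \<open>If \<open>2 ^ m \<ge> Y\<close>, a subcell of generation \<open>m\<close> is
      subcritical. One power of \<open>u\<close> is spent on \<open>r \<le> \<rho> x * u\<close>,
      the other \<open>N0\<close> powers and \<open>C0\<close> on the loss from
      \<open>\<rho> x\<close> to the critical radius at the centre of the subcell.\<close>
    define Y where "Y = C0 * u powr (N0 + 1)"
    have Y: "1 \<le> Y"
    proof -
      have "1 * 1 \<le> C0 * u powr (N0 + 1)" using C0 u N0 by (intro mult_mono ge_one_powr_ge_zero) auto
      then show ?thesis by (simp add: Y_def)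
    qed
    \<comment> \<open>Rounding up to a power of 2 costs at most a factor 2, which keeps
      \<open>2 ^ m0\<close> polynomial in \<open>u\<close>.\<close>
    define m0 where "m0 = nat \<lceil>log 2 Y\<rceil>"
    have lY: "0 \<le> log 2 Y" using Y by simp
    have m0: "Y \<le> 2 ^ m0" "2 ^ m0 \<le> 2 * Y"
    proof -
      have "real m0 = of_int \<lceil>log 2 Y\<rceil>" using lY by (simp add: m0_def)
      then have "log 2 Y \<le> real m0" "real m0 \<le> log 2 Y + 1" by linarith+
      then have "2 powr (log 2 Y) \<le> 2 powr (real m0)" "2 powr real m0 \<le> 2 powr (log 2 Y + 1)"
        by (auto intro!: powr_mono)
      then show "Y \<le> 2 ^ m0" "2 ^ m0 \<le> 2 * Y" using Y by (auto simp: powr_realpow powr_add)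
    qed
    define h where "h = r / sqrt (real n)"
    have h: "0 < h" using r by (simp add: h_def n_def)
    \<comment> \<open>With lower corner \<open>a\<close> and side \<open>2 * h\<close>, the cell of
      generation 0 is \<open>cube x r\<close> together with part of its boundary.\<close>
    define a :: "real ^ 'n" where "a = (\<chi> i. x $ i - h)"
    define l where "l = 2 * h"
    have l: "0 < l" using h by (simp add: l_def)
    define D where "D = dyadic_cell a l"
    define Q where "Q = D 0 x"
    interpret dyadic_filtration Q D "2 ^ CARD('n)"
      unfolding Q_def D_def by (rule dyadic_filtration_dyadic_cell[OF l])
    have memQ: "y \<in> Q \<longleftrightarrow> (\<forall>i. 0 \<le> y $ i - x $ i + h \<and> y $ i - x $ i + h < 2 * h)" for y
    proof -
      have *: "\<lfloor>(x $ i - a $ i) / l\<rfloor> = 0" for i using h by (simp add: a_def l_def)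
      show ?thesis unfolding Q_def D_def dyadic_cell_def using h
        by (simp add: * floor_eq_iff a_def l_def field_simps)
    qed
    have cubeQ: "cube x r \<subseteq> Q"
    proof
      fix y assume "y \<in> cube x r"
      then have "\<bar>y $ i - x $ i\<bar> < h" for i by (simp add: mem_cube h_def n_def)
      then show "y \<in> Q" unfolding memQ by (smt (verit))
    qed
    have normQ: "norm (x - y) \<le> r" if "y \<in> Q" for y
    proof (rule norm_diff_le_of_coordinates_le)
      fix i
      show "\<bar>y $ i - x $ i\<bar> \<le> r / sqrt (real CARD('n))"
        using that[unfolded memQ, rule_format, of i] unfolding h_def[symmetric] n_def[symmetric] by linarith
    qed (use r in simp)
    have lh: "sqrt (real CARD('n)) * (l / 2) = r" by (simp add: l_def h_def n_def)
    have Qeq: "emeasure lebesgue Q = emeasure lebesgue (cube x r)"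
    proof -
      have "emeasure lebesgue Q = ennreal ((l / 2 ^ 0) ^ CARD('n))"
        unfolding Q_def D_def by (rule emeasure_dyadic_cell[OF l])
      also have "l / 2 ^ 0 = 2 * r / sqrt (real CARD('n))" by (simp add: l_def h_def n_def)
      finally show ?thesis by (simp only: emeasure_cube[OF r, of x])
    qed
    have null: "Q - cube x r \<in> null_sets lebesgue"
      using emeasure_Diff[of lebesgue "cube x r" Q] Q_sets Q_finite Qeq cubeQ by (auto simp: null_sets_def)
    have null_S: "N \<in> null_sets S" if "N \<in> null_sets lebesgue" for N
      using that by (auto simp: S_def null_sets_density_iff intro: AE_not_in eventually_mono)
    have SQ: "emeasure S Q = ennreal (measure S (cube x r))"
      using emeasure_Un_null_set[OF _ null_S[OF null], of "cube x r"] cubeQ S_cube[OF r, of x]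
      by (simp add: Un_absorb1)
    have "(\<integral>\<^sup>+y\<in>Q. ennreal (\<sigma> y powr (1 + \<delta>)) \<partial>lebesgue)
      \<le> ennreal (((2 ^ CARD('n)) ^ m0 * (measure S (cube x r) / measure lebesgue (cube x r))) powr \<delta> * measure S (cube x r)
         * (1 + (2 * 2 ^ CARD('n)) powr \<delta> / (1 - (2 * 2 ^ CARD('n)) powr \<delta> * \<beta>)))"
    proof (rule reverse_Hoelder)
      show "emeasure (density lebesgue (\<lambda>x. ennreal (\<sigma> x))) Q = ennreal (measure S (cube x r))"
        using SQ by (simp add: S_def)
      show "emeasure lebesgue Q = ennreal (measure lebesgue (cube x r))"
        unfolding Qeq emeasure_cube[OF r] measure_cube[OF r] ..
      show "(2 * 2 ^ CARD('n)) powr \<delta> * \<beta> < 1" using \<delta>\<beta> by (simp add: B_def n_def)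
    next
      fix z m E
      assume z: "z \<in> Q" and m: "m0 \<le> m" and E[measurable]: "E \<in> sets lebesgue" and sub: "E \<subseteq> D m z"
        and half: "2 * emeasure lebesgue E \<le> emeasure lebesgue (D m z)"
      obtain c where c: "c \<in> D m z" "cube c (r / 2 ^ m) \<subseteq> D m z" "D m z - cube c (r / 2 ^ m) \<in> null_sets lebesgue"
        using dyadic_cell_cube[OF l, of a m z] unfolding lh D_def by metis
      let ?c = "cube c (r / 2 ^ m)"
      have small: "r / 2 ^ m \<le> \<rho> c"
      proof -
        have "c \<in> Q" using c(1) D_subset[OF z] by auto
        then have nr: "norm (x - c) \<le> r" by (rule normQ)
        have "Y \<le> 2 ^ m" using order_trans[OF m0(1) power_increasing[OF m]] by simp
        then have "r / 2 ^ m \<le> r / Y"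
          using r Y by (intro divide_left_mono) auto
        also have "\<dots> = inverse C0 * (r / u) * u powr (- N0)"
          using u by (simp add: Y_def powr_add powr_minus divide_inverse mult_ac)
        also have "\<dots> \<le> inverse C0 * \<rho> x * u powr (- N0)"
        proof -
          have "r \<le> \<rho> x * u" using \<rho>_pos[of x] by (simp add: u_def field_simps)
          then have "r / u \<le> \<rho> x" using u by (simp add: field_simps)
          then show ?thesis using C0 by (intro mult_right_mono mult_left_mono) auto
        qed
        also have "\<dots> \<le> inverse C0 * \<rho> x * (1 + norm (x - c) / \<rho> x) powr (- N0)"
        proof (rule mult_left_mono)
          have "0 \<le> norm (x - c) / \<rho> x" "norm (x - c) / \<rho> x \<le> r / \<rho> x"
            using \<rho>_pos[of x] nr by (auto intro: divide_right_mono)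
          then show "u powr (- N0) \<le> (1 + norm (x - c) / \<rho> x) powr (- N0)"
            using N0 by (intro powr_mono2') (auto simp: u_def)
          show "0 \<le> inverse C0 * \<rho> x" using C0 \<rho>_pos[of x] by simp
        qed
        also have "\<dots> \<le> \<rho> c" by (rule \<rho>_lower)
        finally show ?thesis .
      qed
      have un: "?c \<union> (D m z - ?c) = D m z" using c(2) by blast
      have eqS: "emeasure S (D m z) = emeasure S ?c"
        using emeasure_Un_null_set[OF _ null_S[OF c(3)], of ?c] unfolding un by simp
      have eqL: "emeasure lebesgue (D m z) = emeasure lebesgue ?c"
        using emeasure_Un_null_set[OF cube_sets[of c "r / 2 ^ m"] c(3)] unfolding un .
      \<comment> \<open>\<open>A_inf\<close> speaks of open cubes, so \<open>E\<close> is cut down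
        to the interior of the cell. The discarded part lies in the boundary, which is null for both
        measures.\<close>
      have "E - ?c \<subseteq> D m z - ?c" using sub by blast
      then have nullE: "E - ?c \<in> null_sets lebesgue"
        by (rule null_sets_subset[OF c(3), rotated]) measurable
      have "emeasure S E = emeasure S (E \<inter> ?c \<union> (E - ?c))" by (simp only: Int_Diff_Un)
      also have "\<dots> = emeasure S (E \<inter> ?c)"
        by (rule emeasure_Un_null_set[OF _ null_S[OF nullE]]) simp
      also have "\<dots> \<le> ennreal \<beta> * emeasure S ?c"
      proof (rule A_inf)
        have "2 * emeasure lebesgue (E \<inter> ?c) \<le> 2 * emeasure lebesgue E"
          by (rule mult_left_mono[OF emeasure_mono]) auto
        also note half
        finally show "2 * emeasure lebesgue (E \<inter> ?c) \<le> emeasure lebesgue ?c"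
          unfolding eqL .
        show "0 < r / 2 ^ m" using r by simp
        show "r / 2 ^ m \<le> \<rho> c" by (rule small)
        show "E \<inter> ?c \<in> sets lebesgue" by (intro sets.Int E cube_sets)
      qed blast
      finally show "emeasure (density lebesgue (\<lambda>x. ennreal (\<sigma> x))) E
          \<le> ennreal \<beta> * emeasure (density lebesgue (\<lambda>x. ennreal (\<sigma> x))) (D m z)"
        using eqS by (simp add: S_def)
    qed (use \<beta> \<delta> \<sigma>_pos in \<open>auto intro: less_imp_le\<close>)
    also have "\<dots> \<le> ennreal (((2 * C0) ^ n) powr \<delta> * G * u powr ((N0 + 1) * n * \<delta>)
          * (measure S (cube x r) / measure lebesgue (cube x r)) powr \<delta> * measure S (cube x r))"
    proof (rule ennreal_leI)
      let ?s = "measure S (cube x r)" and ?V = "measure lebesgue (cube x r)"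
      \<comment> \<open>The starting level exceeds the mean by this factor, at most
        \<open>(2 * Y) ^ n\<close>; its power \<open>\<delta>\<close> gives the growth exponent
        \<open>(N0 + 1) * n * \<delta>\<close>.\<close>
      have "((2::real) ^ CARD('n)) ^ m0 = (2 ^ m0) ^ n" by (simp add: n_def power_mult[symmetric] mult.commute)
      also have "\<dots> \<le> (2 * Y) ^ n" using m0(2) by (intro power_mono) auto
      also have "\<dots> = (2 * C0) ^ n * u powr ((N0 + 1) * n)"
        using u by (simp add: Y_def power_mult_distrib powr_realpow[symmetric] powr_powr)
      finally have "((2 ^ CARD('n)) ^ m0 * (?s / ?V)) powr \<delta> \<le> ((2 * C0) ^ n * u powr ((N0 + 1) * n) * (?s / ?V)) powr \<delta>"
        using \<delta> by (intro powr_mono2 mult_right_mono) auto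
      also have "\<dots> = ((2 * C0) ^ n) powr \<delta> * u powr ((N0 + 1) * n * \<delta>) * (?s / ?V) powr \<delta>"
      proof -
        have "(A * U * X) powr \<delta> = A powr \<delta> * U powr \<delta> * X powr \<delta>"
          if "0 \<le> A" "0 \<le> U" "0 \<le> X" for A U X :: real
          using that by (simp add: powr_mult)
        from this[of "(2 * C0) ^ n" "u powr ((N0 + 1) * n)" "?s / ?V"] show ?thesis
          using C0 by (simp only: powr_powr powr_ge_zero zero_le_power zero_le_divide_iff measure_nonneg zero_le_mult_iff) simp
      qed
      finally have "((2 ^ CARD('n)) ^ m0 * (?s / ?V)) powr \<delta> * (?s * G)
          \<le> ((2 * C0) ^ n) powr \<delta> * u powr ((N0 + 1) * n * \<delta>) * (?s / ?V) powr \<delta> * (?s * G)"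
        using G by (intro mult_right_mono) auto
      then show "((2 ^ CARD('n)) ^ m0 * (?s / ?V)) powr \<delta> * ?s * (1 + (2 * 2 ^ CARD('n)) powr \<delta> / (1 - (2 * 2 ^ CARD('n)) powr \<delta> * \<beta>))
          \<le> ((2 * C0) ^ n) powr \<delta> * G * u powr ((N0 + 1) * n * \<delta>) * (?s / ?V) powr \<delta> * ?s"
        unfolding G_def B_def n_def by (simp add: mult_ac)
    qed
    finally have "(\<integral>\<^sup>+y\<in>Q. ennreal (\<sigma> y powr (1 + \<delta>)) \<partial>lebesgue)
       \<le> ennreal (((2 * C0) ^ n) powr \<delta> * G * u powr ((N0 + 1) * n * \<delta>)
          * (measure S (cube x r) / measure lebesgue (cube x r)) powr \<delta> * measure S (cube x r))" .
    moreover have "(\<integral>\<^sup>+y\<in>cube x r. ennreal (\<sigma> y powr (1 + \<delta>)) \<partial>lebesgue)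
        \<le> (\<integral>\<^sup>+y\<in>Q. ennreal (\<sigma> y powr (1 + \<delta>)) \<partial>lebesgue)"
      using cubeQ by (intro nn_integral_mono) (auto simp: indicator_def)
    ultimately show ?thesis unfolding u_def by (rule order_trans[rotated])
  qed
  then show ?thesis
    by (intro that[of \<delta> "((2 * C0) ^ n) powr \<delta> * G" "(N0 + 1) * n * \<delta>"]) (use \<delta> G C0 N0 in auto)
qed

text \<open>The condition \<open>A\<^sub>s\<close> for some \<open>s < p\<close>, applied to the averages of a function.\<close>

lemma average_bound:
  obtains s K \<kappa> where "1 < s" "s < p" "0 < K" "0 \<le> \<kappa>"
    "\<And>x r f T. 0 < r \<Longrightarrow> 0 \<le> T \<Longrightarrow> f \<in> borel_measurable lebesgue \<Longrightarrow> (\<And>y. 0 \<le> f y) \<Longrightarrow>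
      ennreal (T * measure lebesgue (cube x r)) \<le> (\<integral>\<^sup>+y\<in>cube x r. ennreal (f y) \<partial>lebesgue) \<Longrightarrow>
      ennreal (T powr s) * emeasure W (cube x r)
        \<le> ennreal (K * (1 + r / \<rho> x) powr \<kappa>) * (\<integral>\<^sup>+y\<in>cube x r. ennreal (f y powr s * v y) \<partial>lebesgue)"
proof -
  obtain \<delta> K \<kappa> where \<delta>: "0 < \<delta>" and K: "0 < K" and \<kappa>: "0 \<le> \<kappa>" and RH:
    "\<And>x r. 0 < r \<Longrightarrow> (\<integral>\<^sup>+y\<in>cube x r. ennreal (\<sigma> y powr (1 + \<delta>)) \<partial>lebesgue)
      \<le> ennreal (K * (1 + r / \<rho> x) powr \<kappa> * (measure S (cube x r) / measure lebesgue (cube x r)) powr \<delta> * measure S (cube x r))"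
    using dual_reverse_Hoelder by blast
  \<comment> \<open>The solution of \<open>(1 + \<delta>) * (e - 1) = p - 1\<close>. Then
    \<open>v powr (- 1 / (e - 1))\<close> equals \<open>\<sigma> powr (1 + \<delta>)\<close>, the
    quantity controlled by \<open>RH\<close>.\<close>
  define e where "e = 1 + (p - 1) / (1 + \<delta>)"
  have e: "1 < e" "e < p"
  proof -
    show "1 < e" using p \<delta> by (simp add: e_def)
    have "(p - 1) / (1 + \<delta>) < (p - 1) / 1" using p \<delta> by (intro divide_strict_left_mono) auto
    then show "e < p" by (simp add: e_def)
  qed
  have ex: "(1 + \<delta>) * (e - 1) = p - 1" using \<delta> by (simp add: e_def)
  have ex2: "- 1 / (e - 1) = - 1 / (p - 1) * (1 + \<delta>)" using ex p \<delta> e by (simp add: field_simps)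
  have "ennreal (T powr e) * emeasure W (cube x r)
        \<le> ennreal (K powr (e - 1) * C * (1 + r / \<rho> x) powr (\<kappa> * (e - 1) + \<theta>)) * (\<integral>\<^sup>+y\<in>cube x r. ennreal (f y powr e * v y) \<partial>lebesgue)"
    if r: "0 < r" and T: "0 \<le> T" and [measurable]: "f \<in> borel_measurable lebesgue" and f: "\<And>y. 0 \<le> f y"
      and avg: "ennreal (T * measure lebesgue (cube x r)) \<le> (\<integral>\<^sup>+y\<in>cube x r. ennreal (f y) \<partial>lebesgue)" for x r f T
  proof -
    define u where "u = 1 + r / \<rho> x"
    have u: "1 \<le> u" using r \<rho>_pos[of x] by (simp add: u_def)
    define V where "V = measure lebesgue (cube x r)"
    have V: "0 < V" using r by (simp add: V_def measure_cube)
    define s where "s = measure S (cube x r)"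
    define w where "w = measure W (cube x r)"
    have nn: "0 \<le> s" "0 \<le> w" by (auto simp: s_def w_def)
    define H where "H = K powr (e - 1) * C * u powr (\<kappa> * (e - 1) + \<theta>)"
    have H: "0 < H" using K C u by (simp add: H_def)
    show ?thesis
    proof (cases "(\<integral>\<^sup>+y\<in>cube x r. ennreal (f y powr e * v y) \<partial>lebesgue)")
      case top
      have "ennreal H * top = top" using H by (subst ennreal_mult_top) auto
      then show ?thesis unfolding top H_def u_def by simp
    next
      case (real a)
      define b where "b = enn2real (\<integral>\<^sup>+y\<in>cube x r. ennreal (\<sigma> y powr (1 + \<delta>)) \<partial>lebesgue)"
      define G where "G = K * u powr \<kappa> * (s / V) powr \<delta> * s"
      have G: "0 \<le> G" using K nn by (simp add: G_def)
      have RHx: "(\<integral>\<^sup>+y\<in>cube x r. ennreal (\<sigma> y powr (1 + \<delta>)) \<partial>lebesgue) \<le> ennreal G"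
        using RH[OF r, of x] by (simp add: G_def u_def s_def V_def)
      have b: "(\<integral>\<^sup>+y\<in>cube x r. ennreal (\<sigma> y powr (1 + \<delta>)) \<partial>lebesgue) = ennreal b" "0 \<le> b"
        unfolding b_def using le_less_trans[OF RHx ennreal_less_top] by simp_all
      have bG: "b \<le> G" using RHx b(1) G by (simp add: ennreal_le_iff)
      have "ennreal (T * V) \<le> ennreal (a powr (1 / e) * b powr ((e - 1) / e))"
      proof (rule order_trans[OF avg[folded V_def]], rule nn_integral_le_weighted_Hoelder[where w = v])
        show "(\<integral>\<^sup>+y\<in>cube x r. ennreal (v y powr (- 1 / (e - 1))) \<partial>lebesgue) = ennreal b"
          using b(1) unfolding ex2 by (simp add: \<sigma>_def powr_powr)
      qed (use real b f e v_pos in auto)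
      then have "T * V \<le> a powr (1 / e) * b powr ((e - 1) / e)" by (simp add: ennreal_le_iff)
      then have "(T * V) powr e \<le> (a powr (1 / e) * b powr ((e - 1) / e)) powr e"
        using T V e by (intro powr_mono2) auto
      also have "\<dots> = a * b powr (e - 1)" using real b e by (simp add: powr_mult powr_powr)
      also have "\<dots> \<le> a * G powr (e - 1)" using real b bG e by (intro mult_left_mono powr_mono2) auto
      \<comment> \<open>Writing \<open>G\<close> with \<open>(s / V) powr (1 + \<delta>) * V\<close>
        makes the power \<open>e - 1\<close> produce exactly the dual factor
        \<open>(s / V) powr (p - 1)\<close> of the weight condition.\<close>
      also have "G powr (e - 1) = K powr (e - 1) * u powr (\<kappa> * (e - 1)) * ((s / V) powr (p - 1) * V powr (e - 1))"
      proof -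
        have "G = K * u powr \<kappa> * ((s / V) powr (1 + \<delta>) * V)"
          using nn V by (cases "s = 0") (auto simp: G_def powr_add)
        then show ?thesis using K u V nn by (simp add: powr_mult powr_powr ex)
      qed
      finally have "(T * V) powr e * (w / V) \<le> a * (K powr (e - 1) * u powr (\<kappa> * (e - 1)) * ((s / V) powr (p - 1) * V powr (e - 1))) * (w / V)"
        using nn V by (intro mult_right_mono) auto
      also have "\<dots> = a * K powr (e - 1) * u powr (\<kappa> * (e - 1)) * V powr (e - 1) * (w / V * (s / V) powr (p - 1))"
        by (simp add: mult_ac)
      also have "\<dots> \<le> a * K powr (e - 1) * u powr (\<kappa> * (e - 1)) * V powr (e - 1) * (C * u powr \<theta>)"
        using Ap_cube[OF r, of x] real unfolding s_def w_def V_def u_def by (intro mult_left_mono) auto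
      also have "(T * V) powr e * (w / V) = V powr (e - 1) * (T powr e * w)"
        using T V by (simp add: powr_mult powr_diff)
      also have "a * K powr (e - 1) * u powr (\<kappa> * (e - 1)) * V powr (e - 1) * (C * u powr \<theta>) = V powr (e - 1) * (H * a)"
        by (simp add: H_def powr_add mult_ac)
      finally have "T powr e * w \<le> H * a" using V by simp
      then have "ennreal (T powr e * w) \<le> ennreal (H * a)" by (rule ennreal_leI)
      then show ?thesis
        using nn H real W_cube[OF r, of x] unfolding H_def[symmetric] u_def[symmetric]
        by (simp add: ennreal_mult w_def)
    qed
  qed
  then show ?thesis
    by (intro that[of e "K powr (e - 1) * C" "\<kappa> * (e - 1) + \<theta>"]) (use e K C \<kappa> \<theta> in auto)
qed

end

section \<open>The weak type inequality\<close>

text \<open>Greedy selection: a cube of largest radius is kept, every cube meeting it lies in its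
  triple, and the induction hypothesis treats the cubes disjoint from it.\<close>

lemma finite_Vitali_cubes:
  fixes J :: "((real ^ 'n) \<times> real) set"
  assumes "finite J" "\<forall>(x, r)\<in>J. 0 < r"
  shows "\<exists>J'\<subseteq>J. disjoint_family_on (\<lambda>(x, r). cube x r) J' \<and>
    (\<Union>(x, r)\<in>J. cube x r) \<subseteq> (\<Union>(x, r)\<in>J'. cube x (3 * r))"
  using assms
proof (induction J rule: finite_psubset_induct)
  case (psubset J)
  show ?case
  proof (cases "J = {}")
    case False
    define R where "R = Max (snd ` J)"
    have "R \<in> snd ` J" unfolding R_def using psubset.hyps False by (intro Max_in) auto
    then obtain x where xR: "(x, R) \<in> J" by auto
    have R: "0 < R" using psubset.prems xR by auto
    have le: "r \<le> R" if "(y, r) \<in> J" for y r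
      unfolding R_def using psubset.hyps that by (intro Max_ge) force+
    define J1 where "J1 = {(y, r) \<in> J. cube y r \<inter> cube x R = {}}"
    have "x \<in> cube x R" using R by (simp add: mem_cube)
    then have "(x, R) \<notin> J1" by (auto simp: J1_def)
    then have J1: "J1 \<subset> J" using xR by (auto simp: J1_def)
    moreover have "\<forall>(x, r)\<in>J1. 0 < r" using J1 psubset.prems by blast
    ultimately have "\<exists>J'\<subseteq>J1. disjoint_family_on (\<lambda>(x, r). cube x r) J' \<and>
      (\<Union>(x, r)\<in>J1. cube x r) \<subseteq> (\<Union>(x, r)\<in>J'. cube x (3 * r))"
      by (rule psubset.IH)
    then obtain J' where J': "J' \<subseteq> J1" "disjoint_family_on (\<lambda>(x, r). cube x r) J'"
      "(\<Union>(x, r)\<in>J1. cube x r) \<subseteq> (\<Union>(x, r)\<in>J'. cube x (3 * r))"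
      by blast
    have "disjoint_family_on (\<lambda>(x, r). cube x r) (insert (x, R) J')"
      using J'(1,2) unfolding disjoint_family_on_def J1_def by fastforce
    moreover have "cube y r \<subseteq> (\<Union>(x, r)\<in>insert (x, R) J'. cube x (3 * r))" if "(y, r) \<in> J" for y r
    proof (cases "(y, r) \<in> J1")
      case True
      then show ?thesis using J'(3) by auto
    next
      case False
      then have "cube y r \<inter> cube x R \<noteq> {}" using that by (auto simp: J1_def)
      then show ?thesis using cube_subset_triple le[OF that] by blast
    qed
    ultimately show ?thesis
      using J'(1) xR J1 by (intro exI[of _ "insert (x, R) J'"]) auto
  next
    case True
    then show ?thesis by (simp add: disjoint_family_on_def)
  qed
qed

text \<open>Finite families are covered by the triples of disjoint members, whose
  \<open>N\<close>-masses add up to at most the total mass. Lindelof's theorem and an increasing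
  union extend the bound to \<open>G\<close>. No bound on the radii enters, because a largest cube
  is only chosen within finite families.\<close>

lemma emeasure_Union_cubes_le:
  fixes G :: "((real ^ 'n) \<times> real) set"
  assumes sets: "sets M = sets lebesgue" "sets N = sets lebesgue"
    and pos: "\<And>x r. (x, r) \<in> G \<Longrightarrow> 0 < r"
    and le: "\<And>x r. (x, r) \<in> G \<Longrightarrow> emeasure M (cube x (3 * r)) \<le> c * emeasure N (cube x r)"
  shows "emeasure M (\<Union>(x, r)\<in>G. cube x r) \<le> c * emeasure N (space N)"
proof -
  have fin: "emeasure M (\<Union>(x, r)\<in>J. cube x r) \<le> c * emeasure N (space N)" if J: "finite J" "J \<subseteq> G" for J
  proof -
    obtain J' where J': "J' \<subseteq> J" "disjoint_family_on (\<lambda>(x, r). cube x r) J'"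
      "(\<Union>(x, r)\<in>J. cube x r) \<subseteq> (\<Union>(x, r)\<in>J'. cube x (3 * r))"
      using finite_Vitali_cubes[OF J(1)] J(2) pos by blast
    have finJ': "finite J'" using J'(1) J(1) finite_subset by auto
    have "emeasure M (\<Union>(x, r)\<in>J. cube x r) \<le> emeasure M (\<Union>(x, r)\<in>J'. cube x (3 * r))"
      using J'(3) finJ' by (intro emeasure_mono) (auto simp: sets)
    also have "\<dots> \<le> (\<Sum>(x, r)\<in>J'. emeasure M (cube x (3 * r)))"
      using emeasure_subadditive_finite[OF finJ', of "\<lambda>(x, r). cube x (3 * r)" M]
      by (auto simp: sets split_beta image_subset_iff)
    also have "\<dots> \<le> (\<Sum>(x, r)\<in>J'. c * emeasure N (cube x r))"
      using le J' J by (intro sum_mono) auto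
    also have "\<dots> = c * (\<Sum>j\<in>J'. emeasure N (case j of (x, r) \<Rightarrow> cube x r))"
      by (simp add: sum_distrib_left split_beta)
    also have "(\<Sum>j\<in>J'. emeasure N (case j of (x, r) \<Rightarrow> cube x r)) = emeasure N (\<Union>(x, r)\<in>J'. cube x r)"
      using sum_emeasure[OF _ J'(2) finJ', of N] by (auto simp: sets image_subset_iff split_beta)
    also have "c * \<dots> \<le> c * emeasure N (space N)"
      by (intro mult_left_mono emeasure_space) auto
    finally show ?thesis .
  qed
  define \<C> where "\<C> = (\<lambda>(x, r). cube x r) ` G"
  have "\<And>A. A \<in> \<C> \<Longrightarrow> open A" by (auto simp: \<C>_def open_cube)
  then obtain \<C>' where \<C>': "\<C>' \<subseteq> \<C>" "countable \<C>'" "\<Union>\<C>' = \<Union>\<C>"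
    by (rule Lindelof) blast
  obtain G' where G': "countable G'" "G' \<subseteq> G" "\<C>' = (\<lambda>(x, r). cube x r) ` G'"
    using \<C>'(1,2) countable_subset_image[of \<C>' "\<lambda>(x, r). cube x r" G] unfolding \<C>_def by blast
  have eq: "(\<Union>(x, r)\<in>G. cube x r) = (\<Union>(x, r)\<in>G'. cube x r)"
    using \<C>'(3) unfolding \<C>_def G'(3) by simp
  show ?thesis
  proof (cases "G' = {}")
    case True
    then show ?thesis by (simp add: eq)
  next
    case False
    define g where "g = from_nat_into G'"
    have g: "range g = G'" unfolding g_def using False G'(1) by (rule range_from_nat_into)
    define A where "A n = (\<Union>(x, r)\<in>g ` {..<n}. cube x r)" for n :: nat
    have A: "range A \<subseteq> sets M" "incseq A"
    proof -
      show "range A \<subseteq> sets M" by (auto simp: A_def sets intro!: sets.finite_UN split: prod.splits)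
      show "incseq A" unfolding A_def incseq_def by (intro allI impI UN_mono image_mono) auto
    qed
    have "(\<Union>n. \<Union>j\<in>g ` {..<n}. B j) = (\<Union>j\<in>range g. B j)" for B :: "(real ^ 'n) \<times> real \<Rightarrow> (real ^ 'n) set"
      using lessI by (auto simp: image_iff)
    then have "(\<Union>n. A n) = (\<Union>(x, r)\<in>G'. cube x r)" unfolding A_def g[symmetric] .
    then have "emeasure M (\<Union>(x, r)\<in>G. cube x r) = (SUP n. emeasure M (A n))"
      using SUP_emeasure_incseq[OF A] eq by simp
    also have "\<dots> \<le> c * emeasure N (space N)"
      unfolding A_def using G'(2) g by (intro SUP_least fin) auto
    finally show ?thesis .
  qed
qed

context Ap_weight
begin

text \<open>On a cube selected at height \<open>t\<close> the mean of \<open>\<bar>f\<bar>\<close>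
  exceeds \<open>t * u powr \<theta>'\<close> with \<open>u = 1 + r / \<rho> x\<close>. The gain
  \<open>u powr (- \<theta>' * s)\<close> from this has to cancel \<open>u powr \<kappa>\<close>
  twice: once from the averaging inequality and once from tripling the cube.\<close>

lemma weak_type:
  obtains s A \<theta>' where "1 < s" "s < p" "0 < A" "0 \<le> \<theta>'"
    "\<And>f t. f \<in> borel_measurable lebesgue \<Longrightarrow> 0 < t \<Longrightarrow>
       emeasure W {x. ennreal t < maximal \<rho> \<theta>' f x}
         \<le> ennreal (A * t powr (- s)) * (\<integral>\<^sup>+y. ennreal (\<bar>f y\<bar> powr s * v y) \<partial>lebesgue)"
proof -
  obtain s K \<kappa> where s: "1 < s" "s < p" and K: "0 < K" and \<kappa>: "0 \<le> \<kappa>" and avg: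
    "\<And>x r f T. 0 < r \<Longrightarrow> 0 \<le> T \<Longrightarrow> f \<in> borel_measurable lebesgue \<Longrightarrow> (\<And>y. 0 \<le> f y) \<Longrightarrow>
      ennreal (T * measure lebesgue (cube x r)) \<le> (\<integral>\<^sup>+y\<in>cube x r. ennreal (f y) \<partial>lebesgue) \<Longrightarrow>
      ennreal (T powr s) * emeasure W (cube x r)
        \<le> ennreal (K * (1 + r / \<rho> x) powr \<kappa>) * (\<integral>\<^sup>+y\<in>cube x r. ennreal (f y powr s * v y) \<partial>lebesgue)"
    using average_bound by blast
  define n where "n = CARD('n)"
  define c where "c = (3 ^ n) powr s * K * 3 powr \<kappa>"
  have c: "0 < c" using K by (simp add: c_def)
  \<comment> \<open>The averaging inequality on the tripled cube, for the indicator of the original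
    one, whose mean is \<open>1 / 3 ^ n\<close>. The factor \<open>3 powr \<kappa>\<close> in
    \<open>c\<close> comes from
    \<open>1 + 3 * r / \<rho> x \<le> 3 * (1 + r / \<rho> x)\<close>.\<close>
  have doubling: "emeasure W (cube x (3 * r)) \<le> ennreal (c * (1 + r / \<rho> x) powr \<kappa>) * emeasure W (cube x r)"
    if r: "0 < r" for x r
  proof -
    have sub: "cube x r \<subseteq> cube x (3 * r)" using r by (intro cube_mono) auto
    define T :: real where "T = 1 / 3 ^ n"
    have T: "0 < T" by (simp add: T_def)
    have "ennreal (T powr s) * emeasure W (cube x (3 * r)) \<le> ennreal (K * (1 + 3 * r / \<rho> x) powr \<kappa>) *
        (\<integral>\<^sup>+y\<in>cube x (3 * r). ennreal (indicator (cube x r) y powr s * v y) \<partial>lebesgue)"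
    proof (rule avg)
      have "T * measure lebesgue (cube x (3 * r)) = measure lebesgue (cube x r)"
        using r by (simp add: measure_cube T_def n_def power_mult_distrib[symmetric] power_one_over[symmetric] del: power_one_over)
      then have "ennreal (T * measure lebesgue (cube x (3 * r))) = emeasure lebesgue (cube x r)"
        using r by (simp only: emeasure_cube measure_cube)
      also have "\<dots> = (\<integral>\<^sup>+y\<in>cube x (3 * r). ennreal (indicator (cube x r) y) \<partial>lebesgue)"
        unfolding nn_integral_indicator[OF cube_sets, symmetric]
        using sub by (intro nn_integral_cong) (auto simp: indicator_def)
      finally show "ennreal (T * measure lebesgue (cube x (3 * r))) \<le> \<dots>" by simp
    qed (use r T in auto)
    also have "(\<integral>\<^sup>+y\<in>cube x (3 * r). ennreal (indicator (cube x r) y powr s * v y) \<partial>lebesgue) = emeasure W (cube x r)"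
      unfolding emeasure_W[OF cube_sets] using sub by (intro nn_integral_cong) (auto simp: indicator_def)
    finally have le: "ennreal (T powr s) * emeasure W (cube x (3 * r)) \<le> ennreal (K * (1 + 3 * r / \<rho> x) powr \<kappa>) * emeasure W (cube x r)" .
    have "(1 + 3 * r / \<rho> x) powr \<kappa> \<le> (3 * (1 + r / \<rho> x)) powr \<kappa>"
      using r \<rho>_pos[of x] \<kappa> by (intro powr_mono2) auto
    also have "\<dots> = 3 powr \<kappa> * (1 + r / \<rho> x) powr \<kappa>"
      using r \<rho>_pos[of x] by (intro powr_mult)
    finally have "K * (1 + 3 * r / \<rho> x) powr \<kappa> \<le> K * (3 powr \<kappa> * (1 + r / \<rho> x) powr \<kappa>)"
      using K by simp
    then have "ennreal (K * (1 + 3 * r / \<rho> x) powr \<kappa>) * emeasure W (cube x r)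
        \<le> ennreal (K * (3 powr \<kappa> * (1 + r / \<rho> x) powr \<kappa>)) * emeasure W (cube x r)"
      by (intro mult_right_mono ennreal_leI) auto
    with le have "ennreal (T powr s) * emeasure W (cube x (3 * r))
        \<le> ennreal (K * (3 powr \<kappa> * (1 + r / \<rho> x) powr \<kappa>)) * emeasure W (cube x r)"
      by (rule order_trans)
    then have "ennreal ((3 ^ n) powr s) * (ennreal (T powr s) * emeasure W (cube x (3 * r)))
        \<le> ennreal ((3 ^ n) powr s) * (ennreal (K * (3 powr \<kappa> * (1 + r / \<rho> x) powr \<kappa>)) * emeasure W (cube x r))"
      by (intro mult_left_mono) auto
    moreover have "ennreal ((3 ^ n) powr s) * ennreal (T powr s) = 1"
      by (simp add: ennreal_mult[symmetric] T_def powr_mult[symmetric])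
    moreover have "ennreal ((3 ^ n) powr s) * ennreal (K * (3 powr \<kappa> * (1 + r / \<rho> x) powr \<kappa>)) = ennreal (c * (1 + r / \<rho> x) powr \<kappa>)"
      using K by (simp add: ennreal_mult[symmetric] c_def mult_ac)
    ultimately show ?thesis by (simp add: mult.assoc[symmetric])
  qed
  \<comment> \<open>Exactly the value with \<open>\<theta>' * s = 2 * \<kappa>\<close>, which
    balances the two losses.\<close>
  define \<theta>' where "\<theta>' = 2 * \<kappa> / s"
  have \<theta>': "0 \<le> \<theta>'" using \<kappa> s by (simp add: \<theta>'_def)
  have "emeasure W {x. ennreal t < maximal \<rho> \<theta>' f x}
         \<le> ennreal (c * K * t powr (- s)) * (\<integral>\<^sup>+y. ennreal (\<bar>f y\<bar> powr s * v y) \<partial>lebesgue)"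
    if f[measurable]: "f \<in> borel_measurable lebesgue" and t: "0 < t" for f t
  proof -
    define avgc where "avgc = (\<lambda>(x, r). ennreal ((1 + r / \<rho> x) powr (- \<theta>') * (1 / measure lebesgue (cube x r))) *
        (\<integral>\<^sup>+y\<in>cube x r. ennreal \<bar>f y\<bar> \<partial>lebesgue))"
    define G where "G = {(x, r). 0 < r \<and> ennreal t < avgc (x, r)}"
    have level: "{x. ennreal t < maximal \<rho> \<theta>' f x} = (\<Union>(x, r)\<in>G. cube x r)"
      unfolding maximal_def less_SUP_iff G_def avgc_def by auto
    define N where "N = density lebesgue (\<lambda>y. ennreal (\<bar>f y\<bar> powr s * v y))"
    have "emeasure W (\<Union>(x, r)\<in>G. cube x r) \<le> ennreal (c * K * t powr (- s)) * emeasure N (space N)"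
    proof (rule emeasure_Union_cubes_le)
      fix x r assume G: "(x, r) \<in> G"
      then have r: "0 < r" and big: "ennreal t < avgc (x, r)" by (auto simp: G_def)
      define u where "u = 1 + r / \<rho> x"
      have u: "1 \<le> u" using r \<rho>_pos[of x] by (simp add: u_def)
      define V where "V = measure lebesgue (cube x r)"
      have V: "0 < V" using r by (simp add: V_def measure_cube)
      define T where "T = t * u powr \<theta>'"
      have T: "0 < T" using t u by (simp add: T_def)
      let ?I = "\<integral>\<^sup>+y\<in>cube x r. ennreal \<bar>f y\<bar> \<partial>lebesgue"
      have "ennreal (u powr \<theta>' * V) * ennreal t \<le> ennreal (u powr \<theta>' * V) * (ennreal (u powr (- \<theta>') * (1 / V)) * ?I)"
        using big unfolding avgc_def u_def V_def by (intro mult_left_mono) auto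
      moreover have "ennreal (u powr \<theta>' * V) * ennreal (u powr (- \<theta>') * (1 / V)) = 1"
        using u V by (simp add: ennreal_mult[symmetric] powr_minus field_simps)
      moreover have "ennreal (u powr \<theta>' * V) * ennreal t = ennreal (T * V)"
        using t V by (simp add: ennreal_mult[symmetric] T_def mult_ac)
      ultimately have "ennreal (T * V) \<le> ?I" by (simp add: mult.assoc[symmetric])
      then have "ennreal (T powr s) * emeasure W (cube x r)
        \<le> ennreal (K * u powr \<kappa>) * (\<integral>\<^sup>+y\<in>cube x r. ennreal (\<bar>f y\<bar> powr s * v y) \<partial>lebesgue)"
        unfolding V_def u_def using r T by (intro avg) auto
      also have "(\<integral>\<^sup>+y\<in>cube x r. ennreal (\<bar>f y\<bar> powr s * v y) \<partial>lebesgue) = emeasure N (cube x r)"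
        unfolding N_def by (simp add: emeasure_density)
      finally have le: "ennreal (T powr s) * emeasure W (cube x r) \<le> ennreal (K * u powr \<kappa>) * emeasure N (cube x r)" .
      have Ts: "T powr s = t powr s * u powr (2 * \<kappa>)"
        using t u s by (simp add: T_def powr_mult powr_powr \<theta>'_def)
      have "emeasure W (cube x (3 * r)) \<le> ennreal (c * u powr \<kappa>) * emeasure W (cube x r)"
        using doubling[OF r] by (simp add: u_def)
      also have "ennreal (c * u powr \<kappa>) = ennreal (c * u powr \<kappa> * T powr (- s)) * ennreal (T powr s)"
        using c T by (subst ennreal_mult[symmetric]) (auto simp: powr_minus field_simps)
      also have "\<dots> * emeasure W (cube x r) \<le> ennreal (c * u powr \<kappa> * T powr (- s)) * (ennreal (K * u powr \<kappa>) * emeasure N (cube x r))"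
        unfolding mult.assoc[of _ "ennreal (T powr s)"] by (intro mult_left_mono le) auto
      also have "\<dots> = ennreal (c * u powr \<kappa> * T powr (- s) * (K * u powr \<kappa>)) * emeasure N (cube x r)"
        using c K by (simp add: ennreal_mult mult.assoc)
      also have "c * u powr \<kappa> * T powr (- s) * (K * u powr \<kappa>) = c * K * t powr (- s)"
      proof -
        have "u powr \<kappa> * u powr \<kappa> = u powr (2 * \<kappa>)" by (simp add: powr_add[symmetric])
        moreover have "T powr (- s) = t powr (- s) * inverse (u powr (2 * \<kappa>))"
          using Ts by (simp add: powr_minus)
        moreover have "u powr (2 * \<kappa>) \<noteq> 0" using u by simp
        moreover have "c * U * (t powr (- s) * inverse Z) * (K * U) = c * K * t powr (- s)" if "U * U = Z" "Z \<noteq> 0" for U Z :: real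
          using that by (simp add: field_simps)
        ultimately show ?thesis by metis
      qed
      finally show "emeasure W (cube x (3 * r)) \<le> ennreal (c * K * t powr (- s)) * emeasure N (cube x r)" .
    qed (auto simp: N_def G_def)
    also have "emeasure N (space N) = (\<integral>\<^sup>+y. ennreal (\<bar>f y\<bar> powr s * v y) \<partial>lebesgue)"
      unfolding N_def by (simp add: emeasure_density)
    finally show ?thesis unfolding level .
  qed
  then show ?thesis using c K s \<theta>' by (intro that[of s "c * K" \<theta>']) auto
qed

end

section \<open>Interpolation\<close>

lemma Phi_nonneg: "0 \<le> Phi p q t"
  by (simp add: Phi_def)

text \<open>Shrinking the argument cannot increase the logarithmic factor. This is monotonicity of
  \<open>Phi p q t / t powr p\<close> in multiplicative form; it gives the decay in the
  interpolation and later absorbs constants into the norm.\<close>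

lemma Phi_scale:
  assumes "0 < p" "0 \<le> q" "0 \<le> c" "c \<le> 1" "0 \<le> t"
  shows "Phi p q (c * t) \<le> c powr p * Phi p q t"
proof (cases "c * t = 0")
  case True
  then show ?thesis using Phi_nonneg[of p q t] by (auto simp: Phi_def)
next
  case False
  then have ct: "0 < c" "0 < t" using assms by auto
  then have "ln (c * t) \<le> ln t" using assms by (simp add: mult_le_cancel_right1)
  then have "(1 + max 0 (ln (c * t))) powr q \<le> (1 + max 0 (ln t)) powr q"
    using assms by (intro powr_mono2) auto
  then have "(c * t) powr p * (1 + max 0 (ln (c * t))) powr q \<le> (c * t) powr p * (1 + max 0 (ln t)) powr q"
    by (intro mult_left_mono) auto
  then show ?thesis using ct by (simp add: Phi_def powr_mult mult.assoc)
qed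

lemma Phi_mono:
  assumes "0 < p" "0 \<le> q" "0 \<le> s" "s \<le> t"
  shows "Phi p q s \<le> Phi p q t"
proof (cases "t = 0")
  case False
  then have t: "0 < t" using assms by auto
  have "Phi p q (s / t * t) \<le> (s / t) powr p * Phi p q t"
    using assms t by (intro Phi_scale) auto
  also have "\<dots> \<le> 1 * Phi p q t"
    using assms t Phi_nonneg by (intro mult_right_mono powr_le1) auto
  finally show ?thesis using t by simp
qed (use assms in auto)

lemma measurable_Phi[measurable]: "Phi p q \<in> borel_measurable borel"
  unfolding Phi_def[abs_def] by measurable

text \<open>Counted downwards from the largest admissible \<open>k\<close>, the terms are dominated
  by a geometric series of ratio \<open>2 powr (- d)\<close>. The sum over all integers is written
  as an integral so that Tonelli's theorem applies to it.\<close>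

lemma geometric_count_space_le:
  fixes y d :: real
  assumes d: "0 < d" and y: "0 < y"
  shows "(\<integral>\<^sup>+k. ennreal ((2 powr real_of_int k / y) powr d) * indicator {k. 2 powr real_of_int k < y} k \<partial>count_space UNIV)
    \<le> ennreal (1 / (1 - 2 powr (- d)))"
proof -
  \<comment> \<open>The largest integer with \<open>2 powr K < y\<close>. The inequality is strict,
    so it is the ceiling minus 1 and not the floor, which differs when \<open>y\<close> is a power
    of 2.\<close>
  define K where "K = \<lceil>log 2 y\<rceil> - 1"
  have less_iff: "2 powr real_of_int k < y \<longleftrightarrow> k \<le> K" for k
  proof -
    have "2 powr real_of_int k < y \<longleftrightarrow> real_of_int k < log 2 y" using y by (simp add: less_log_iff)
    also have "\<dots> \<longleftrightarrow> k < \<lceil>log 2 y\<rceil>" by (simp add: less_ceiling_iff)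
    finally show ?thesis by (auto simp: K_def)
  qed
  have bij: "bij_betw (\<lambda>j. K - int j) UNIV {..K}"
    by (rule bij_betw_byWitness[where f' = "\<lambda>k. nat (K - k)"]) auto
  let ?f = "\<lambda>k::int. ennreal ((2 powr k / y) powr d) * indicator {k. 2 powr real_of_int k < y} k"
  have "(\<integral>\<^sup>+k. ?f k \<partial>count_space UNIV) = (\<integral>\<^sup>+k. ?f k \<partial>count_space {..K})"
    by (intro nn_integral_count_space_eq) (auto simp: less_iff)
  also have "\<dots> = (\<integral>\<^sup>+j. ?f (K - int j) \<partial>count_space UNIV)"
    by (rule nn_integral_bij_count_space[OF bij, symmetric])
  also have "\<dots> = (\<Sum>j. ?f (K - int j))" by (rule nn_integral_count_space_nat)
  also have "\<dots> \<le> (\<Sum>j. ennreal ((2 powr (- d)) ^ j))"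
  proof (intro suminf_le summableI)
    fix j
    have "2 powr real_of_int (K - int j) / y = 2 powr K / y * 2 powr (- real j)"
      by (simp add: powr_diff powr_minus field_simps)
    also have "\<dots> \<le> 1 * 2 powr (- real j)"
      using y less_iff[of K] by (intro mult_right_mono) auto
    finally have "(2 powr real_of_int (K - int j) / y) powr d \<le> (2 powr (- real j)) powr d"
      using d y by (intro powr_mono2) auto
    also have "\<dots> = (2 powr (- d)) ^ j"
      by (simp add: powr_powr powr_realpow[symmetric] mult.commute)
    finally show "?f (K - int j) \<le> ennreal ((2 powr (- d)) ^ j)"
      by (auto simp: indicator_def ennreal_leI)
  qed
  also have "\<dots> = ennreal (1 / (1 - 2 powr (- d)))"
    using d by (intro suminf_ennreal_eq geometric_sums) (auto simp: powr_less_one)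
  finally show ?thesis .
qed

text \<open>The part of \<open>f\<close> of size at most \<open>t\<close> contributes at most
  \<open>t\<close> to each weighted mean, because the factor
  \<open>(1 + r / \<rho> x0) powr (- \<theta>)\<close> is at most 1. This is the bounded endpoint of
  the interpolation.\<close>

lemma maximal_truncate:
  assumes \<rho>: "\<And>x. 0 < \<rho> x" and \<theta>: "0 \<le> \<theta>" and f[measurable]: "f \<in> borel_measurable lebesgue" and t: "0 < t"
    and x: "ennreal (2 * t) < maximal \<rho> \<theta> f x"
  shows "ennreal t < maximal \<rho> \<theta> (\<lambda>y. if t < \<bar>f y\<bar> then f y else 0) x"
proof -
  define g where "g y = (if t < \<bar>f y\<bar> then f y else 0)" for y
  have g[measurable]: "g \<in> borel_measurable lebesgue" unfolding g_def[abs_def] by measurable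
  obtain x0 r where r: "0 < r" "x \<in> cube x0 r" and big: "ennreal (2 * t) <
      ennreal ((1 + r / \<rho> x0) powr (- \<theta>) * (1 / measure lebesgue (cube x0 r))) * (\<integral>\<^sup>+y\<in>cube x0 r. ennreal \<bar>f y\<bar> \<partial>lebesgue)"
    using x unfolding maximal_def less_SUP_iff by auto
  define V where "V = measure lebesgue (cube x0 r)"
  have V: "0 < V" using r by (simp add: V_def measure_cube)
  define a where "a = (1 + r / \<rho> x0) powr (- \<theta>) * (1 / V)"
  have a: "0 \<le> a" "a * V \<le> 1"
  proof -
    have "1 powr \<theta> \<le> (1 + r / \<rho> x0) powr \<theta>" using r \<rho>[of x0] \<theta> by (intro powr_mono2) auto
    then show "0 \<le> a" "a * V \<le> 1" using V by (auto simp: a_def powr_minus inverse_le_1_iff)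
  qed
  have "(\<integral>\<^sup>+y\<in>cube x0 r. ennreal \<bar>f y\<bar> \<partial>lebesgue) \<le>
      (\<integral>\<^sup>+y. ennreal \<bar>g y\<bar> * indicator (cube x0 r) y + ennreal t * indicator (cube x0 r) y \<partial>lebesgue)"
    using t by (intro nn_integral_mono) (auto simp: g_def indicator_def ennreal_leI)
  also have "\<dots> = (\<integral>\<^sup>+y\<in>cube x0 r. ennreal \<bar>g y\<bar> \<partial>lebesgue) + ennreal t * emeasure lebesgue (cube x0 r)"
    by (subst nn_integral_add) (auto simp: nn_integral_cmult)
  also have "emeasure lebesgue (cube x0 r) = ennreal V"
    using r by (simp only: V_def emeasure_cube measure_cube)
  finally have "ennreal a * (\<integral>\<^sup>+y\<in>cube x0 r. ennreal \<bar>f y\<bar> \<partial>lebesgue)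
      \<le> ennreal a * ((\<integral>\<^sup>+y\<in>cube x0 r. ennreal \<bar>g y\<bar> \<partial>lebesgue) + ennreal t * ennreal V)"
    by (intro mult_left_mono) auto
  also have "\<dots> = ennreal a * (\<integral>\<^sup>+y\<in>cube x0 r. ennreal \<bar>g y\<bar> \<partial>lebesgue) + ennreal (a * V * t)"
    using a V t by (simp add: distrib_left ennreal_mult mult_ac)
  also have "\<dots> \<le> ennreal a * (\<integral>\<^sup>+y\<in>cube x0 r. ennreal \<bar>g y\<bar> \<partial>lebesgue) + ennreal t"
    using a t by (intro add_left_mono ennreal_leI mult_left_le_one_le) (auto intro: mult_nonneg_nonneg simp: V less_imp_le)
  finally have le: "ennreal (2 * t) < ennreal a * (\<integral>\<^sup>+y\<in>cube x0 r. ennreal \<bar>g y\<bar> \<partial>lebesgue) + ennreal t"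
    using big unfolding a_def V_def by (rule less_le_trans[rotated])
  have "ennreal t < ennreal a * (\<integral>\<^sup>+y\<in>cube x0 r. ennreal \<bar>g y\<bar> \<partial>lebesgue)"
  proof (rule ccontr)
    assume "\<not> ?thesis"
    then have "ennreal a * (\<integral>\<^sup>+y\<in>cube x0 r. ennreal \<bar>g y\<bar> \<partial>lebesgue) + ennreal t \<le> ennreal t + ennreal t"
      by (intro add_right_mono) auto
    also have "\<dots> = ennreal (2 * t)" using t by (simp add: ennreal_plus[symmetric] del: ennreal_plus)
    finally show False using le by simp
  qed
  also have "\<dots> \<le> maximal \<rho> \<theta> g x"
    unfolding maximal_def using r by (intro SUP_upper2[of "(x0, r)"]) (auto simp: a_def V_def)
  finally show ?thesis unfolding g_def[abs_def] .
qed

context Ap_weight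
begin

text \<open>A discrete layer-cake argument, which requires no derivative of \<open>Phi\<close>.
  Where the maximal function lies between \<open>2 * b k\<close> and \<open>4 * b k\<close>, the
  function \<open>Phi\<close> of it is at most \<open>Phi p q (4 * b k)\<close>; the corresponding
  level set is estimated by the weak type bound for \<open>f\<close> truncated at
  \<open>b k\<close>. After exchanging sum and integral, only levels
  \<open>b k < \<bar>f x\<bar>\<close> remain at \<open>x\<close>.\<close>

lemma modular_maximal_le:
  assumes q: "0 \<le> q"
  obtains \<theta>' A where "0 \<le> \<theta>'" "0 < A"
    "\<And>f. f \<in> borel_measurable lebesgue \<Longrightarrow>
       modular (Phi p q) v (maximal \<rho> \<theta>' f) \<le> ennreal A * (\<integral>\<^sup>+x. ennreal (Phi p q (4 * \<bar>f x\<bar>) * v x) \<partial>lebesgue)"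
proof -
  obtain s A \<theta>' where s: "1 < s" "s < p" and A: "0 < A" and \<theta>': "0 \<le> \<theta>'" and weak:
    "\<And>f t. f \<in> borel_measurable lebesgue \<Longrightarrow> 0 < t \<Longrightarrow>
       emeasure W {x. ennreal t < maximal \<rho> \<theta>' f x}
         \<le> ennreal (A * t powr (- s)) * (\<integral>\<^sup>+y. ennreal (\<bar>f y\<bar> powr s * v y) \<partial>lebesgue)"
    using weak_type by blast
  have p0: "0 < p" using p by simp
  \<comment> \<open>The value of the geometric series of ratio \<open>2 powr (- (p - s))\<close>,
    finite because \<open>s < p\<close>.\<close>
  define G where "G = 1 / (1 - 2 powr (- (p - s)))"
  have G: "0 < G" using s by (simp add: G_def powr_less_one)
  have "modular (Phi p q) v (maximal \<rho> \<theta>' f) \<le> ennreal (A * G) * (\<integral>\<^sup>+x. ennreal (Phi p q (4 * \<bar>f x\<bar>) * v x) \<partial>lebesgue)"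
    if f[measurable]: "f \<in> borel_measurable lebesgue" for f
  proof -
    define M where "M = maximal \<rho> \<theta>' f"
    define b where "b k = 2 powr real_of_int k" for k :: int
    have b: "0 < b k" for k by (simp add: b_def)
    define E where "E k = {x. ennreal (2 * b k) < M x}" for k
    define g where "g k y = (if b k < \<bar>f y\<bar> then f y else 0)" for k y
    have g[measurable]: "g k \<in> borel_measurable lebesgue" for k unfolding g_def[abs_def] by measurable
    have "E k \<in> sets borel" for k
      using borel_measurable_maximal[of \<rho> \<theta>' f] unfolding E_def M_def by measurable
    then have E[measurable]: "E k \<in> sets lebesgue" for k by (simp add: sets_completionI_sets)
    have E_le: "emeasure W (E k) \<le> ennreal (A * b k powr (- s)) * (\<integral>\<^sup>+y. ennreal (\<bar>g k y\<bar> powr s * v y) \<partial>lebesgue)" for k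
    proof -
      have "E k \<subseteq> {x. ennreal (b k) < maximal \<rho> \<theta>' (g k) x}"
        using maximal_truncate[OF \<rho>_pos \<theta>' f b] by (auto simp: E_def M_def g_def[abs_def])
      moreover have "{x. ennreal (b k) < maximal \<rho> \<theta>' (g k) x} \<in> sets borel"
        using borel_measurable_maximal[of \<rho> \<theta>' "g k"] by measurable
      ultimately have "emeasure W (E k) \<le> emeasure W {x. ennreal (b k) < maximal \<rho> \<theta>' (g k) x}"
        by (intro emeasure_mono) auto
      then show ?thesis using weak[OF g b] by (rule order_trans)
    qed
    have pw: "Young_ext (Phi p q) (M x) \<le> (\<integral>\<^sup>+k. ennreal (Phi p q (4 * b k)) * indicator (E k) x \<partial>count_space UNIV)" (is "_ \<le> ?R") for x
    proof -
      have point: "ennreal (Phi p q (4 * b k)) \<le> ?R" if "x \<in> E k" for k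
        using nn_integral_ge_point[of k UNIV "\<lambda>k. ennreal (Phi p q (4 * b k)) * indicator (E k) x"] that by simp
      show ?thesis
      proof (cases "M x")
        case (real y)
        show ?thesis
        proof (cases "y = 0")
          case True
          then show ?thesis using real by (simp add: Young_ext_def Phi_def)
        next
          case False
          then have y: "0 < y" using real by simp
          \<comment> \<open>With the ceiling minus 2 one has
            \<open>2 * b k < y \<le> 4 * b k\<close>: strict on the left to enter
            \<open>E k\<close>, weak on the right for the comparison of \<open>Phi\<close>.\<close>
          define k where "k = \<lceil>log 2 y\<rceil> - 2"
          have k: "real_of_int k + 1 < log 2 y" "log 2 y \<le> real_of_int k + 2"
            unfolding k_def by linarith+
          have "2 * b k = 2 powr (real_of_int k + 1)" by (simp add: b_def powr_add)
          also have "\<dots> < y" using k(1) y by (simp add: less_log_iff)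
          finally have "x \<in> E k" using real b[of k] by (simp add: E_def ennreal_less_iff)
          have "y \<le> 2 powr (real_of_int k + 2)" using k(2) y by (simp add: log_le_iff)
          also have "\<dots> = 4 * b k" by (simp add: b_def powr_add)
          finally have "Phi p q y \<le> Phi p q (4 * b k)" using y p0 q by (intro Phi_mono) auto
          then have "ennreal (Phi p q y) \<le> ennreal (Phi p q (4 * b k))" by (rule ennreal_leI)
          then show ?thesis using point[OF \<open>x \<in> E k\<close>] real by (simp add: Young_ext_def)
        qed
      next
        \<comment> \<open>Here \<open>x\<close> lies in every \<open>E k\<close>, and the terms
          \<open>Phi p q (4 * b k)\<close> are unbounded, so the right-hand side is infinite as
          well.\<close>
        case top
        have ge: "of_nat n \<le> ?R" for n
        proof -
          have "real n \<le> 4 * b (int n)"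
          proof -
            have "real n < 2 ^ n" by (rule of_nat_less_two_power)
            moreover have "b (int n) = 2 ^ n" by (simp add: b_def powr_realpow)
            ultimately show ?thesis using b[of "int n"] by linarith
          qed
          also have "\<dots> = (4 * b (int n)) powr 1" using b[of "int n"] by simp
          also have "\<dots> \<le> (4 * b (int n)) powr p"
          proof (rule powr_mono)
            have "1 \<le> b (int n)" by (simp add: b_def powr_realpow)
            then show "1 \<le> 4 * b (int n)" by simp
          qed (use p in simp)
          also have "\<dots> \<le> Phi p q (4 * b (int n))"
          proof -
            have "1 \<le> (1 + max 0 (ln (4 * b (int n)))) powr q" using q by (intro ge_one_powr_ge_zero) auto
            then have "(4 * b (int n)) powr p * 1 \<le> Phi p q (4 * b (int n))"
              unfolding Phi_def by (intro mult_left_mono) auto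
            then show ?thesis by simp
          qed
          finally have "ennreal (real n) \<le> ennreal (Phi p q (4 * b (int n)))" by (rule ennreal_leI)
          also have "\<dots> \<le> ?R" by (rule point) (simp add: E_def top)
          finally show ?thesis by (simp add: ennreal_of_nat_eq_real_of_nat)
        qed
        have "\<not> ?R < top"
        proof
          assume "?R < top"
          then obtain n where "?R < of_nat n" using ennreal_Ex_less_of_nat by blast
          then show False using leD[OF ge[of n]] by blast
        qed
        then have "?R = top" using less_top by blast
        then show ?thesis by simp
      qed
    qed
    have "modular (Phi p q) v M \<le> (\<integral>\<^sup>+x. (\<integral>\<^sup>+k. ennreal (Phi p q (4 * b k)) * (ennreal (v x) * indicator (E k) x) \<partial>count_space UNIV) \<partial>lebesgue)"
      unfolding modular_def
    proof (rule nn_integral_mono)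
      fix x
      have "Young_ext (Phi p q) (M x) * ennreal (v x) \<le> (\<integral>\<^sup>+k. ennreal (Phi p q (4 * b k)) * indicator (E k) x \<partial>count_space UNIV) * ennreal (v x)"
        by (intro mult_right_mono pw) auto
      also have "\<dots> = (\<integral>\<^sup>+k. ennreal (Phi p q (4 * b k)) * indicator (E k) x * ennreal (v x) \<partial>count_space UNIV)"
        by (simp add: nn_integral_multc)
      finally show "Young_ext (Phi p q) (M x) * ennreal (v x) \<le> (\<integral>\<^sup>+k. ennreal (Phi p q (4 * b k)) * (ennreal (v x) * indicator (E k) x) \<partial>count_space UNIV)"
        by (simp add: mult_ac)
    qed
    also have "\<dots> = (\<integral>\<^sup>+k. (\<integral>\<^sup>+x. ennreal (Phi p q (4 * b k)) * (ennreal (v x) * indicator (E k) x) \<partial>lebesgue) \<partial>count_space UNIV)"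
      by (rule nn_integral_count_space_nn_integral) auto
    also have "\<dots> \<le> (\<integral>\<^sup>+k. (\<integral>\<^sup>+x. ennreal (Phi p q (4 * b k) * (A * b k powr (- s))) * ennreal (\<bar>g k x\<bar> powr s * v x) \<partial>lebesgue) \<partial>count_space UNIV)"
    proof (rule nn_integral_mono)
      fix k
      have "(\<integral>\<^sup>+x. ennreal (Phi p q (4 * b k)) * (ennreal (v x) * indicator (E k) x) \<partial>lebesgue) = ennreal (Phi p q (4 * b k)) * emeasure W (E k)"
        by (simp add: nn_integral_cmult emeasure_W)
      also have "\<dots> \<le> ennreal (Phi p q (4 * b k)) * (ennreal (A * b k powr (- s)) * (\<integral>\<^sup>+y. ennreal (\<bar>g k y\<bar> powr s * v y) \<partial>lebesgue))"
        by (intro mult_left_mono E_le) auto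
      also have "\<dots> = (\<integral>\<^sup>+x. ennreal (Phi p q (4 * b k) * (A * b k powr (- s))) * ennreal (\<bar>g k x\<bar> powr s * v x) \<partial>lebesgue)"
        using A by (simp add: nn_integral_cmult ennreal_mult' ennreal_mult'' Phi_nonneg mult.assoc)
      finally show "(\<integral>\<^sup>+x. ennreal (Phi p q (4 * b k)) * (ennreal (v x) * indicator (E k) x) \<partial>lebesgue) \<le> \<dots>" .
    qed
    also have "\<dots> = (\<integral>\<^sup>+x. (\<integral>\<^sup>+k. ennreal (Phi p q (4 * b k) * (A * b k powr (- s))) * ennreal (\<bar>g k x\<bar> powr s * v x) \<partial>count_space UNIV) \<partial>lebesgue)"
      by (rule nn_integral_count_space_nn_integral[symmetric]) auto
    also have "\<dots> \<le> (\<integral>\<^sup>+x. ennreal (A * G) * ennreal (Phi p q (4 * \<bar>f x\<bar>) * v x) \<partial>lebesgue)"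
    proof (rule nn_integral_mono)
      fix x
      define y where "y = \<bar>f x\<bar>"
      define H where "H = A * Phi p q (4 * y) * v x"
      have H: "0 \<le> H" using A v_pos[of x] Phi_nonneg[of p q "4 * y"] by (simp add: H_def)
      show "(\<integral>\<^sup>+k. ennreal (Phi p q (4 * b k) * (A * b k powr (- s))) * ennreal (\<bar>g k x\<bar> powr s * v x) \<partial>count_space UNIV)
          \<le> ennreal (A * G) * ennreal (Phi p q (4 * \<bar>f x\<bar>) * v x)" (is "?L \<le> _")
      proof (cases "y = 0")
        case True
        then have "g k x = 0" for k by (simp add: g_def y_def)
        then show ?thesis by simp
      next
        case False
        then have y: "0 < y" by (simp add: y_def)
        have "?L \<le> (\<integral>\<^sup>+k. ennreal H * (ennreal ((2 powr real_of_int k / y) powr (p - s)) * indicator {k. 2 powr real_of_int k < y} k) \<partial>count_space UNIV)"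
        proof (rule nn_integral_mono)
          fix k
          show "ennreal (Phi p q (4 * b k) * (A * b k powr (- s))) * ennreal (\<bar>g k x\<bar> powr s * v x)
            \<le> ennreal H * (ennreal ((2 powr real_of_int k / y) powr (p - s)) * indicator {k. 2 powr real_of_int k < y} k)"
          proof (cases "b k < y")
            case False
            then show ?thesis by (simp add: g_def y_def)
          next
            case True
            \<comment> \<open>Descending from \<open>4 * y\<close> to \<open>4 * b k\<close> gains
              \<open>(b k / y) powr p\<close>, of which the weak type factor
              \<open>b k powr (- s) * y powr s\<close> takes back
              \<open>(b k / y) powr s\<close>.\<close>
            have "Phi p q (b k / y * (4 * y)) \<le> (b k / y) powr p * Phi p q (4 * y)"
              using True b[of k] y p0 q by (intro Phi_scale) auto
            moreover have "b k / y * (4 * y) = 4 * b k" using y by simp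
            ultimately have "Phi p q (4 * b k) \<le> (b k / y) powr p * Phi p q (4 * y)" by (simp only:)
            then have "Phi p q (4 * b k) * (A * b k powr (- s) * (y powr s * v x))
                \<le> (b k / y) powr p * Phi p q (4 * y) * (A * b k powr (- s) * (y powr s * v x))"
              using A v_pos[of x] by (intro mult_right_mono) auto
            also have "\<dots> = H * ((b k / y) powr p * (b k powr (- s) * y powr s))" by (simp add: H_def mult_ac)
            also have "b k powr (- s) * y powr s = (b k / y) powr (- s)"
              using y b[of k] by (simp add: powr_divide powr_minus field_simps)
            also have "(b k / y) powr p * (b k / y) powr (- s) = (b k / y) powr (p - s)"
              by (simp add: powr_add[symmetric])
            finally have "ennreal (Phi p q (4 * b k) * (A * b k powr (- s) * (y powr s * v x))) \<le> ennreal (H * (b k / y) powr (p - s))"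
              by (rule ennreal_leI)
            then have "ennreal (Phi p q (4 * b k) * (A * b k powr (- s))) * ennreal (y powr s * v x) \<le> ennreal H * ennreal ((b k / y) powr (p - s))"
              using H A v_pos[of x] Phi_nonneg[of p q "4 * b k"] by (simp add: ennreal_mult[symmetric] mult.assoc less_imp_le)
            then show ?thesis using True by (simp add: g_def y_def b_def)
          qed
        qed
        also have "\<dots> = ennreal H * (\<integral>\<^sup>+k. ennreal ((2 powr real_of_int k / y) powr (p - s)) * indicator {k. 2 powr real_of_int k < y} k \<partial>count_space UNIV)"
          by (rule nn_integral_cmult) simp
        also have "\<dots> \<le> ennreal H * ennreal G"
          unfolding G_def using s y by (intro mult_left_mono geometric_count_space_le) auto
        also have "\<dots> = ennreal (A * G) * ennreal (Phi p q (4 * \<bar>f x\<bar>) * v x)"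
        proof -
          have "ennreal H * ennreal G = ennreal (H * G)" using H G by (simp add: ennreal_mult)
          also have "H * G = (A * G) * (Phi p q (4 * \<bar>f x\<bar>) * v x)" by (simp add: H_def y_def)
          also have "ennreal \<dots> = ennreal (A * G) * ennreal (Phi p q (4 * \<bar>f x\<bar>) * v x)"
            using A G v_pos[of x] Phi_nonneg[of p q "4 * \<bar>f x\<bar>"] by (intro ennreal_mult) auto
          finally show ?thesis .
        qed
        finally show ?thesis .
      qed
    qed
    also have "\<dots> = ennreal (A * G) * (\<integral>\<^sup>+x. ennreal (Phi p q (4 * \<bar>f x\<bar>) * v x) \<partial>lebesgue)"
      by (rule nn_integral_cmult) simp
    finally show ?thesis unfolding M_def .
  qed
  then show ?thesis using A G \<theta>' by (intro that[of \<theta>' "A * G"]) auto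
qed

text \<open>The maximal operator is positively homogeneous, so it suffices to divide
  \<open>f\<close> by a large enough multiple of \<open>l\<close>: by \<open>Phi_scale\<close>, the
  dilation 4 and the constant \<open>A\<close> of the modular inequality are both absorbed.\<close>

lemma Orlicz_norm_maximal_le:
  assumes q: "0 \<le> q"
  shows "\<exists>\<theta>'\<ge>0. \<exists>c>0. \<forall>f \<in> borel_measurable lebesgue.
     Orlicz_norm (Phi p q) v (maximal \<rho> \<theta>' f) \<le> ennreal c * Orlicz_norm (Phi p q) v (\<lambda>x. ennreal \<bar>f x\<bar>)"
proof -
  obtain \<theta>' A where \<theta>': "0 \<le> \<theta>'" and A: "0 < A" and modular_le:
    "\<And>f. f \<in> borel_measurable lebesgue \<Longrightarrow>
       modular (Phi p q) v (maximal \<rho> \<theta>' f) \<le> ennreal A * (\<integral>\<^sup>+x. ennreal (Phi p q (4 * \<bar>f x\<bar>) * v x) \<partial>lebesgue)"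
    using modular_maximal_le[OF q] by blast
  have p0: "0 < p" using p by simp
  \<comment> \<open>Large enough for \<open>A * (4 / c) powr p \<le> 1\<close>; the maximum with 1
    gives \<open>4 / c \<le> 1\<close>, as \<open>Phi_scale\<close> demands.\<close>
  define c where "c = 4 * max 1 (A powr (1 / p))"
  have c: "4 \<le> c" by (simp add: c_def)
  have Ac: "A * (4 / c) powr p \<le> 1"
  proof -
    have "A powr (1 / p) \<le> c / 4" by (simp add: c_def)
    then have "(A powr (1 / p)) powr p \<le> (c / 4) powr p" using p0 by (intro powr_mono2) auto
    then have "A \<le> (c / 4) powr p" using A p0 by (simp add: powr_powr)
    then show ?thesis using c by (simp add: powr_divide field_simps)
  qed
  have "Orlicz_norm (Phi p q) v (maximal \<rho> \<theta>' f) \<le> ennreal c * Orlicz_norm (Phi p q) v (\<lambda>x. ennreal \<bar>f x\<bar>)"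
    if f[measurable]: "f \<in> borel_measurable lebesgue" for f
  proof -
    have le: "Orlicz_norm (Phi p q) v (maximal \<rho> \<theta>' f) \<le> ennreal (c * l)"
      if l: "0 < l" and mod: "modular (Phi p q) v (\<lambda>x. ennreal \<bar>f x\<bar> / ennreal l) \<le> 1" for l
    proof -
      define m where "m = c * l"
      have m: "0 < m" using c l by (simp add: m_def)
      define h where "h x = f x / m" for x
      have h[measurable]: "h \<in> borel_measurable lebesgue" unfolding h_def[abs_def] by measurable
      have max_le: "maximal \<rho> \<theta>' f x / ennreal m \<le> maximal \<rho> \<theta>' h x" for x
      proof -
        have "maximal \<rho> \<theta>' f x \<le> ennreal m * maximal \<rho> \<theta>' h x"
          unfolding maximal_def[of \<rho> \<theta>' f]
        proof (rule SUP_least, clarify)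
          fix x0 r assume r: "0 < r" "x \<in> cube x0 r"
          let ?a = "ennreal ((1 + r / \<rho> x0) powr (- \<theta>') * (1 / measure lebesgue (cube x0 r)))"
          have "(\<integral>\<^sup>+y\<in>cube x0 r. ennreal \<bar>f y\<bar> \<partial>lebesgue) = (\<integral>\<^sup>+y. ennreal m * (ennreal \<bar>h y\<bar> * indicator (cube x0 r) y) \<partial>lebesgue)"
            using m by (intro nn_integral_cong) (auto simp: h_def mult.assoc[symmetric] ennreal_mult[symmetric] abs_mult)
          also have "\<dots> = ennreal m * (\<integral>\<^sup>+y\<in>cube x0 r. ennreal \<bar>h y\<bar> \<partial>lebesgue)"
            by (rule nn_integral_cmult) measurable
          finally have "?a * (\<integral>\<^sup>+y\<in>cube x0 r. ennreal \<bar>f y\<bar> \<partial>lebesgue) = ennreal m * (?a * (\<integral>\<^sup>+y\<in>cube x0 r. ennreal \<bar>h y\<bar> \<partial>lebesgue))"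
            by (simp add: mult_ac)
          also have "\<dots> \<le> ennreal m * maximal \<rho> \<theta>' h x"
            unfolding maximal_def using r by (intro mult_left_mono SUP_upper2[of "(x0, r)"]) auto
          finally show "?a * (\<integral>\<^sup>+y\<in>cube x0 r. ennreal \<bar>f y\<bar> \<partial>lebesgue) \<le> ennreal m * maximal \<rho> \<theta>' h x" .
        qed
        then have "maximal \<rho> \<theta>' f x / ennreal m \<le> ennreal m * maximal \<rho> \<theta>' h x / ennreal m"
          by (rule divide_right_mono_ennreal)
        also have "\<dots> = maximal \<rho> \<theta>' h x" 
          using m mult_divide_eq_ennreal[of "ennreal m" "maximal \<rho> \<theta>' h x"] by (simp add: mult.commute)
        finally show ?thesis .
      qed
      have Young_mono: "Young_ext (Phi p q) s \<le> Young_ext (Phi p q) t" if "s \<le> t" for s t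
      proof (cases "t = top")
        case False
        then have "s \<noteq> top" "enn2real s \<le> enn2real t"
          using that by (auto simp: top_unique less_top[symmetric] intro: enn2real_mono)
        then show ?thesis
          using False p0 q by (auto simp: Young_ext_def intro!: ennreal_leI Phi_mono)
      qed (simp add: Young_ext_def)
      have "modular (Phi p q) v (\<lambda>x. maximal \<rho> \<theta>' f x / ennreal m) \<le> modular (Phi p q) v (maximal \<rho> \<theta>' h)"
        unfolding modular_def by (intro nn_integral_mono mult_right_mono Young_mono max_le) auto
      also have "\<dots> \<le> ennreal A * (\<integral>\<^sup>+x. ennreal (Phi p q (4 * \<bar>h x\<bar>) * v x) \<partial>lebesgue)"
        by (rule modular_le) (rule h)
      also have "\<dots> = (\<integral>\<^sup>+x. ennreal A * ennreal (Phi p q (4 * \<bar>h x\<bar>) * v x) \<partial>lebesgue)"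
        by (rule nn_integral_cmult[symmetric]) measurable
      also have "\<dots> \<le> (\<integral>\<^sup>+x. Young_ext (Phi p q) (ennreal \<bar>f x\<bar> / ennreal l) * ennreal (v x) \<partial>lebesgue)"
      proof (rule nn_integral_mono)
        fix x
        have "4 * \<bar>h x\<bar> = 4 / c * (\<bar>f x\<bar> / l)" using c l by (simp add: h_def m_def)
        then have "Phi p q (4 * \<bar>h x\<bar>) \<le> (4 / c) powr p * Phi p q (\<bar>f x\<bar> / l)"
          using Phi_scale[of p q "4 / c" "\<bar>f x\<bar> / l"] c l p0 q by simp
        then have "A * Phi p q (4 * \<bar>h x\<bar>) \<le> A * ((4 / c) powr p * Phi p q (\<bar>f x\<bar> / l))"
          using A by (intro mult_left_mono) auto
        also have "\<dots> \<le> 1 * Phi p q (\<bar>f x\<bar> / l)"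
          unfolding mult.assoc[symmetric] by (intro mult_right_mono Ac Phi_nonneg)
        finally have "A * Phi p q (4 * \<bar>h x\<bar>) * v x \<le> Phi p q (\<bar>f x\<bar> / l) * v x"
          using v_pos[of x] by (intro mult_right_mono) auto
        then have "ennreal (A * Phi p q (4 * \<bar>h x\<bar>) * v x) \<le> ennreal (Phi p q (\<bar>f x\<bar> / l) * v x)"
          by (rule ennreal_leI)
        moreover have "ennreal \<bar>f x\<bar> / ennreal l = ennreal (\<bar>f x\<bar> / l)" using l by (simp add: divide_ennreal)
        ultimately show "ennreal A * ennreal (Phi p q (4 * \<bar>h x\<bar>) * v x) \<le> Young_ext (Phi p q) (ennreal \<bar>f x\<bar> / ennreal l) * ennreal (v x)"
          using A l v_pos[of x] Phi_nonneg[of p q] by (simp add: Young_ext_def ennreal_mult[symmetric] mult.assoc less_imp_le)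
      qed
      also have "\<dots> \<le> 1" using mod by (simp add: modular_def)
      finally show ?thesis
        unfolding Orlicz_norm_def m_def[symmetric] using m by (intro INF_lower) auto
    qed
    let ?N = "Orlicz_norm (Phi p q) v (maximal \<rho> \<theta>' f)"
    \<comment> \<open>Moving \<open>c\<close> to the left allows the infimum to be taken on the
      right; this also covers an empty set of admissible \<open>l\<close>, where the infimum is
      infinite.\<close>
    have "ennreal (1 / c) * ?N \<le> Orlicz_norm (Phi p q) v (\<lambda>x. ennreal \<bar>f x\<bar>)"
      unfolding Orlicz_norm_def[of _ _ "\<lambda>x. ennreal \<bar>f x\<bar>"]
    proof (rule INF_greatest)
      fix l assume "l \<in> {l. 0 < l \<and> modular (Phi p q) v (\<lambda>x. ennreal \<bar>f x\<bar> / ennreal l) \<le> 1}"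
      then have l: "0 < l" and "?N \<le> ennreal (c * l)" using le by auto
      then have "ennreal (1 / c) * ?N \<le> ennreal (1 / c) * ennreal (c * l)" by (intro mult_left_mono) auto
      also have "\<dots> = ennreal l" using c l by (subst ennreal_mult[symmetric]) auto
      finally show "ennreal (1 / c) * ?N \<le> ennreal l" .
    qed
    then have "ennreal c * (ennreal (1 / c) * ?N) \<le> ennreal c * Orlicz_norm (Phi p q) v (\<lambda>x. ennreal \<bar>f x\<bar>)"
      by (rule mult_left_mono) simp
    moreover have "ennreal c * ennreal (1 / c) = 1" using c by (subst ennreal_mult[symmetric]) auto
    ultimately show ?thesis by (simp add: mult.assoc[symmetric])
  qed
  then show ?thesis using \<theta>' c by (intro exI[of _ \<theta>'] exI[of _ c] conjI) auto
qed

end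

section \<open>From the class \<open>A_rho\<close> to an everywhere positive weight\<close>

lemma nn_integral_set_eq_integral:
  fixes f g :: "'a \<Rightarrow> real"
  assumes "set_integrable M A f" "AE x in M. 0 \<le> f x" "AE x in M. g x = f x"
  shows "(\<integral>\<^sup>+x\<in>A. ennreal (g x) \<partial>M) = ennreal (LINT x:A|M. f x)"
proof -
  have "(\<integral>\<^sup>+x\<in>A. ennreal (g x) \<partial>M) = (\<integral>\<^sup>+x. ennreal (indicator A x *\<^sub>R f x) \<partial>M)"
  proof (rule nn_integral_cong_AE)
    show "AE x in M. ennreal (g x) * indicator A x = ennreal (indicator A x *\<^sub>R f x)"
      using assms(3) by eventually_elim (simp add: indicator_def)
  qed
  also have "\<dots> = ennreal (LINT x:A|M. f x)"
    unfolding set_lebesgue_integral_def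
  proof (rule nn_integral_eq_integral)
    show "integrable M (\<lambda>x. indicator A x *\<^sub>R f x)" using assms(1) by (simp only: set_integrable_def)
    show "AE x in M. 0 \<le> indicator A x *\<^sub>R f x"
      using assms(2) by eventually_elim (simp add: indicator_def)
  qed
  finally show ?thesis .
qed

theorem theorem1p3:
  fixes \<rho> w :: "real ^ 'n \<Rightarrow> real" and p q :: real
  assumes "critical_radius \<rho>"
    and "1 < p" and "0 \<le> q"
    and "w \<in> A_rho \<rho> p"
  shows "\<exists>\<theta>\<ge>0. \<exists>C>0. \<forall>f \<in> Orlicz_space (Phi p q) w.
           Orlicz_norm (Phi p q) w (maximal \<rho> \<theta> f)
             \<le> ennreal C * Orlicz_norm (Phi p q) w (\<lambda>x. ennreal \<bar>f x\<bar>)"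
proof -
  obtain C0 N0 where \<rho>: "\<And>x. 0 < \<rho> x" and C0: "1 \<le> C0" "1 \<le> N0" and
    lower: "\<And>x y. inverse C0 * \<rho> x * (1 + norm (x - y) / \<rho> x) powr (- N0) \<le> \<rho> y"
    using assms(1) unfolding critical_radius_def by blast
  \<comment> \<open>These identities eliminate the conjugate exponent
    \<open>p' = p / (p - 1)\<close> from the definition of the class.\<close>
  have p: "1 - p / (p - 1) = - 1 / (p - 1)" "1 / (p / (p - 1)) = (p - 1) / p"
    using assms(2) by (auto simp: field_simps)
  obtain \<theta> C where \<theta>: "0 \<le> \<theta>" and w: "weight w" and C: "0 < C" and Ap: "\<And>x r. 0 < r \<Longrightarrow>
        set_integrable lebesgue (cube x r) (\<lambda>y. w y powr (- 1 / (p - 1))) \<and>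
        (1 / measure lebesgue (cube x r) * (LINT y:cube x r|lebesgue. w y)) powr (1 / p) *
        (1 / measure lebesgue (cube x r) * (LINT y:cube x r|lebesgue. w y powr (- 1 / (p - 1)))) powr ((p - 1) / p)
        \<le> C * (1 + r / \<rho> x) powr \<theta>"
    using assms(4) unfolding A_rho_def A_rho_theta_def Let_def p by blast
  have [measurable]: "w \<in> borel_measurable lebesgue" and w_pos: "AE x in lebesgue. 0 < w x"
    using w unfolding weight_def by (rule conjunct1, rule conjunct1[OF conjunct2])
  \<comment> \<open>Changing \<open>w\<close> on a null set makes it positive everywhere and affects
    neither the averages nor the modulars.\<close>
  define v where "v x = (if 0 < w x then w x else 1)" for x
  have v_eq: "AE x in lebesgue. v x = w x" using w_pos by eventually_elim (simp add: v_def)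
  have v_int: "(\<integral>\<^sup>+y\<in>cube x r. ennreal (v y) \<partial>lebesgue) = ennreal (LINT y:cube x r|lebesgue. w y)" for x r
  proof (rule nn_integral_set_eq_integral)
    let ?a = "\<chi> i. x $ i - r / sqrt (real CARD('n))" and ?b = "\<chi> i. x $ i + r / sqrt (real CARD('n))"
    have "set_integrable lebesgue (cbox ?a ?b) w"
      by (rule w[unfolded weight_def, THEN conjunct2, THEN conjunct2, rule_format, OF compact_cbox])
    then show "set_integrable lebesgue (cube x r) w"
      by (rule set_integrable_subset) (rule cube_sets, unfold cube_def, rule box_subset_cbox)
    show "AE x in lebesgue. 0 \<le> w x" using w_pos by eventually_elim simp
  qed (rule v_eq)
  have dual_int: "(\<integral>\<^sup>+y\<in>cube x r. ennreal (v y powr (- 1 / (p - 1))) \<partial>lebesgue)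
      = ennreal (LINT y:cube x r|lebesgue. w y powr (- 1 / (p - 1)))" if "0 < r" for x r
  proof (rule nn_integral_set_eq_integral)
    show "AE x in lebesgue. v x powr (- 1 / (p - 1)) = w x powr (- 1 / (p - 1))"
      using v_eq by eventually_elim simp
    show "set_integrable lebesgue (cube x r) (\<lambda>y. w y powr (- 1 / (p - 1)))"
      using Ap[OF that] by blast
    show "AE x in lebesgue. 0 \<le> w x powr (- 1 / (p - 1))" by simp
  qed
  have w_nonneg: "0 \<le> (LINT y:cube x r|lebesgue. w y)" for x r
    unfolding set_lebesgue_integral_def
  proof (rule integral_nonneg_AE)
    show "AE y in lebesgue. 0 \<le> indicator (cube x r) y *\<^sub>R w y"
      using w_pos by eventually_elim (simp add: indicator_def)
  qed
  have dual_nonneg: "0 \<le> (LINT y:cube x r|lebesgue. w y powr (- 1 / (p - 1)))" for x r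
    unfolding set_lebesgue_integral_def by (rule integral_nonneg_AE) (simp add: indicator_def)
  \<comment> \<open>Raising the defining inequality to the power \<open>p\<close> replaces
    \<open>C\<close> by \<open>C powr p\<close> and \<open>\<theta>\<close> by
    \<open>\<theta> * p\<close>.\<close>
  interpret Ap_weight \<rho> v p "C powr p" "\<theta> * p" C0 N0
  proof
    show "v \<in> borel_measurable lebesgue" unfolding v_def[abs_def] by measurable
    show "0 < v x" for x by (simp add: v_def)
    show "(\<integral>\<^sup>+y\<in>cube x r. ennreal (v y) \<partial>lebesgue) < \<infinity>" for x r by (simp add: v_int)
    show "(\<integral>\<^sup>+y\<in>cube x r. ennreal (v y powr (- 1 / (p - 1))) \<partial>lebesgue) < \<infinity>" if "0 < r" for x r
      by (simp only: dual_int[OF that]) simp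
    show "enn2real (\<integral>\<^sup>+y\<in>cube x r. ennreal (v y) \<partial>lebesgue) / measure lebesgue (cube x r) *
        (enn2real (\<integral>\<^sup>+y\<in>cube x r. ennreal (v y powr (- 1 / (p - 1))) \<partial>lebesgue) / measure lebesgue (cube x r)) powr (p - 1)
        \<le> C powr p * (1 + r / \<rho> x) powr (\<theta> * p)" if r: "0 < r" for x r
    proof -
      define a where "a = 1 / measure lebesgue (cube x r) * (LINT y:cube x r|lebesgue. w y)"
      define b where "b = 1 / measure lebesgue (cube x r) * (LINT y:cube x r|lebesgue. w y powr (- 1 / (p - 1)))"
      have ab: "0 \<le> a" "0 \<le> b" using w_nonneg dual_nonneg by (auto simp: a_def b_def)
      have "a powr (1 / p) * b powr ((p - 1) / p) \<le> C * (1 + r / \<rho> x) powr \<theta>"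
        using Ap[OF r, of x] by (simp add: a_def b_def)
      then have "(a powr (1 / p) * b powr ((p - 1) / p)) powr p \<le> (C * (1 + r / \<rho> x) powr \<theta>) powr p"
        using assms(2) by (intro powr_mono2) auto
      moreover have "(a powr (1 / p) * b powr ((p - 1) / p)) powr p = a * b powr (p - 1)"
        using ab assms(2) by (simp add: powr_mult powr_powr)
      moreover have "(C * (1 + r / \<rho> x) powr \<theta>) powr p = C powr p * (1 + r / \<rho> x) powr (\<theta> * p)"
        using C by (simp add: powr_mult powr_powr)
      moreover have "enn2real (\<integral>\<^sup>+y\<in>cube x r. ennreal (v y) \<partial>lebesgue) / measure lebesgue (cube x r) = a"
        using w_nonneg by (simp add: v_int a_def)
      moreover have "enn2real (\<integral>\<^sup>+y\<in>cube x r. ennreal (v y powr (- 1 / (p - 1))) \<partial>lebesgue) / measure lebesgue (cube x r) = b"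
        unfolding dual_int[OF r] using dual_nonneg by (simp add: b_def)
      ultimately show ?thesis by simp
    qed
  qed (use assms(2) C \<theta> C0 \<rho> lower in auto)
  have modular_eq: "modular \<Phi> w g = modular \<Phi> v g" for \<Phi> g
    unfolding modular_def
  proof (rule nn_integral_cong_AE)
    show "AE x in lebesgue. Young_ext \<Phi> (g x) * ennreal (w x) = Young_ext \<Phi> (g x) * ennreal (v x)"
      using v_eq by eventually_elim simp
  qed
  have norm_eq: "Orlicz_norm \<Phi> w g = Orlicz_norm \<Phi> v g" for \<Phi> g
    by (simp add: Orlicz_norm_def modular_eq)
  show ?thesis
    using Orlicz_norm_maximal_le[OF assms(3)] unfolding norm_eq Orlicz_space_def by blast
qed

end
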